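(* Let $p>3$ be a prime. Then $$\sum_{n=0}^{(p-1)/2}\frac{6n+1}{256^n}\binom{2n}n^3\equiv p(-1)^{(p-1)/2}+(-1)^{(p-1)/2}\frac{7}{24}p^4B_{p-3}\pmod{p^5}.$$
   Context: $B_0,B_1,\ldots$ are the Bernoulli numbers, defined by $\frac{x}{e^x-1}=\sum_{n\ge0}B_n\frac{x^n}{n!}$. For rational numbers $a,b$ whose denominators are coprime to $p$, $a\equiv b\pmod{p^m}$ means that $(a-b)/p^m$ is a rational number with denominator coprime to $p$. *)

theory Defs
  imports "HOL-Computational_Algebra.Computational_Algebra"
begin

definition bernoulli :: "nat \<Rightarrow> rat" where
  "bernoulli n = fact n * fps_nth (fps_X / (fps_exp 1 - 1)) n"

text \<open>
  The divisor has zero constant term, so the quotient above is not multiplication by an inverse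
  power series; the following confirms that it is the intended one.
\<close>

lemma bernoulli_egf:
  "Abs_fps (\<lambda>n. bernoulli n / fact n) * (fps_exp 1 - 1) = fps_X"
proof -
  let ?d = "fps_exp 1 - 1 :: rat fps"
  have nth1: "fps_nth ?d 1 = 1" by simp
  hence nz: "?d \<noteq> 0" by force
  have "subdegree ?d = 1" by (rule subdegreeI) auto
  hence "?d dvd fps_X" using nz by (simp add: fps_dvd_iff)
  moreover have "Abs_fps (\<lambda>n. bernoulli n / fact n) = fps_X / ?d"
    by (simp add: fps_eq_iff bernoulli_def)
  ultimately show ?thesis by simp
qed

definition p_integral :: "nat \<Rightarrow> rat \<Rightarrow> bool" where
  "p_integral p x \<longleftrightarrow> coprime (snd (quotient_of x)) (int p)"

text \<open>
  The congruence is only meaningful between rationals whose denominators are coprime to \<open>p\<close>,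
  hence the first two conjuncts.
\<close>

definition rat_cong :: "nat \<Rightarrow> nat \<Rightarrow> rat \<Rightarrow> rat \<Rightarrow> bool" where
  "rat_cong p m a b \<longleftrightarrow>
     p_integral p a \<and> p_integral p b \<and> p_integral p ((a - b) / of_nat p ^ m)"

end

theory Submission
  imports Defs
begin

text \<open>
  Write \<open>N = (p - 1) / 2\<close>. Deform the \<open>k\<close>-th summand to \<open>(6 k + 1) t\<^sub>k(x)\<close>, where \<open>x = 0\<close> gives the sum
  in question, and \<open>t\<^sub>k(a\<^sup>2)\<close> is obtained by splitting two of the three factors \<open>(1/2)\<^sub>k\<close> in the
  numerator into \<open>((1 + a)/2)\<^sub>k ((1 - a)/2)\<^sub>k\<close> and two of the factors \<open>k!\<close> in the denominator into
  \<open>(1 + a/4)\<^sub>k (1 - a/4)\<^sub>k\<close>. A WZ pair with step \<open>a \<mapsto> a + 4\<close> shows that for odd \<open>a = 2 j + 1 \<le> p\<close>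
  the deformed sum equals \<open>(-1)\<^sup>j a\<close>. After clearing denominators the deformed sum is a polynomial in
  \<open>x\<close> of degree at most \<open>N\<close>, so Lagrange interpolation at these \<open>N + 1\<close> squares expresses the
  original sum exactly as \<open>p C(2N,N) / 16\<^sup>N\<close> times \<open>\<Sum> C(p, 2m) Q((p - 4m)\<^sup>2)\<close> over \<open>m \<le> N\<close>, with
  \<open>Q(x) = \<Prod> (1 - x / (16 i\<^sup>2))\<close>. The summands with \<open>m > 0\<close> are divisible by \<open>p\<^sup>2\<close>.

  Let \<open>H\<^sub>r = \<Sum> 1 / i\<^sup>r\<close> over \<open>i \<le> N\<close>. Expanding modulo \<open>p\<^sup>4\<close> leaves \<open>H\<^sub>2\<close>, \<open>H\<^sub>3\<close> and a double harmonic sum.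
  Reflections \<open>i \<mapsto> p - i\<close> turn all of them into multiples of \<open>H\<^sub>3\<close>, and Faulhaber's formula at
  \<open>N + 1 \<equiv> 1/2\<close> gives \<open>H\<^sub>3 \<equiv> -2 B\<^bsub>p-3\<^esub>\<close> modulo \<open>p\<close>.
\<close>

section \<open>A WZ pair\<close>

text \<open>For \<open>x = a^2\<close> this is \<open>((1+a)/2)_k ((1-a)/2)_k (1/2)_k / (4^k k!
  (1+a/4)_k (1-a/4)_k)\<close>. Only \<open>a^2\<close> enters, so the parameter is
  \<open>x\<close>; the poles \<open>16 (i+1)^2\<close> are even squares and are never met at odd
  squares.\<close>

definition wz_term :: "rat \<Rightarrow> nat \<Rightarrow> rat" where
  "wz_term x k = (\<Prod>i<k. ((2 * of_nat i + 1)\<^sup>2 - x) * (2 * of_nat i + 1) /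
     (2 * (16 * (of_nat i + 1)\<^sup>2 - x) * (of_nat i + 1)))"

lemma wz_term_0 [simp]: "wz_term x 0 = 1"
  by (simp add: wz_term_def)

lemma wz_term_Suc:
  "wz_term x (Suc k) = wz_term x k * (((2 * of_nat k + 1)\<^sup>2 - x) * (2 * of_nat k + 1) /
     (2 * (16 * (of_nat k + 1)\<^sup>2 - x) * (of_nat k + 1)))"
  by (simp add: wz_term_def)

lemma central_binomial_Suc:
  "(of_nat ((2 * Suc k) choose (Suc k)) :: rat) =
    2 * (2 * of_nat k + 1) * of_nat ((2 * k) choose k) / (of_nat k + 1)"
proof -
  have "F * r * (2 * s) / ((s * f) * (s * f)) = 2 * r * (F / (f * f)) / s" if "s \<noteq> 0" for F r s f :: rat
    using that by (simp add: mult_ac)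
  moreover have "of_nat k + 1 \<noteq> (0 :: rat)" by (simp add: add_nonneg_eq_0_iff)
  moreover have "(fact (2 * Suc k) :: rat) = fact (2 * k) * (2 * of_nat k + 1) * (2 * (of_nat k + 1))"
    by (simp add: algebra_simps)
  moreover have "(fact (Suc k) :: rat) = (of_nat k + 1) * fact k" by simp
  moreover have "2 * Suc k - Suc k = Suc k" "2 * k - k = k" "Suc k \<le> 2 * Suc k" "k \<le> 2 * k" by simp_all
  ultimately show ?thesis by (simp only: binomial_fact)
qed

lemma wz_term_at_0: "wz_term 0 k = of_nat ((2 * k) choose k) ^ 3 / 256 ^ k"
proof (induction k)
  case (Suc k)
  have "B ^ 3 / E * ((r\<^sup>2 - 0) * r / (2 * (16 * s\<^sup>2 - 0) * s)) = (2 * r * B / s) ^ 3 / (256 * E)"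
    for B E r s :: rat by (simp add: power2_eq_square power3_eq_cube mult_ac)
  thus ?case unfolding wz_term_Suc Suc.IH power_Suc central_binomial_Suc .
qed simp

text \<open>The factor with index \<open>j\<close> vanishes, so at odd squares the series terminates
  and the WZ recurrence acquires no boundary term.\<close>

lemma wz_term_eq_0: "j < k \<Longrightarrow> wz_term ((2 * of_nat j + 1)\<^sup>2) k = 0"
  unfolding wz_term_def by (rule prod_zero) auto

lemma odd_neq_4_mult: "odd d \<Longrightarrow> (of_nat d :: rat) \<noteq> 4 * of_nat k"
proof
  assume "odd d" "(of_nat d :: rat) = 4 * of_nat k"
  hence "(of_nat d :: rat) = of_nat (4 * k)" by simp
  hence "d = 4 * k" by (simp only: of_nat_eq_iff)
  with \<open>odd d\<close> show False by simp
qed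

text \<open>Factor the differences of squares. Under \<open>d \<mapsto> d - 4\<close> the linear
  factors of the numerator move by two indices and those of the denominator by one, so the quotient
  telescopes to boundary factors. Oddness and the lower bound keep the denominators away from
  0.\<close>

lemma wz_term_shift:
  fixes n :: nat
  assumes "odd n" "n \<ge> 5"
  defines "d \<equiv> of_nat n :: rat"
  shows "wz_term ((d - 4)\<^sup>2) k = wz_term (d\<^sup>2) k *
    ((2 * of_nat k - d + 1) * (2 * of_nat k - d + 3) * (4 - d) * (4 * of_nat k + d) /
     ((2 * of_nat k + d - 1) * (2 * of_nat k + d - 3) * (4 * of_nat k + 4 - d) * d))"
proof (induction k)
  case 0
  have "d \<ge> 5" using assms by simp
  moreover have "(1 - d) * (3 - d) = (d - 1) * (d - 3)" by (simp add: algebra_simps)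
  ultimately show ?case by simp
next
  case (Suc k)
  have d: "d \<ge> 5" using assms by simp
  define q :: rat where "q = of_nat k"
  have q: "q \<ge> 0" by (simp add: q_def)
  have nz: "4 * q + 4 - d \<noteq> 0" "4 * q + 8 - d \<noteq> 0"
    using odd_neq_4_mult[OF assms(1), of "k + 1"] odd_neq_4_mult[OF assms(1), of "k + 2"]
    by (simp_all add: d_def q_def)
  have pos: "2 * q + d - 1 \<noteq> 0" "2 * q + d - 3 \<noteq> 0" "2 * q + d + 1 \<noteq> 0" "d \<noteq> 0" "q + 1 \<noteq> 0"
    "4 * q + d \<noteq> 0" "4 * q + 4 + d \<noteq> 0" using d q by auto
  have e: "16 * (q + 1)\<^sup>2 - (d - 4)\<^sup>2 = (4 * q + 8 - d) * (4 * q + d)"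
    "16 * (q + 1)\<^sup>2 - d\<^sup>2 = (4 * q + 4 - d) * (4 * q + 4 + d)"
    "(2 * q + 1)\<^sup>2 - (d - 4)\<^sup>2 = (2 * q - d + 5) * (2 * q + d - 3)"
    "(2 * q + 1)\<^sup>2 - d\<^sup>2 = (2 * q - d + 1) * (2 * q + d + 1)"
    by (simp_all add: algebra_simps power2_eq_square)
  have s: "2 * (q + 1) - d + 1 = 2 * q - d + 3" "2 * (q + 1) - d + 3 = 2 * q - d + 5"
    "4 * (q + 1) + d = 4 * q + 4 + d" "2 * (q + 1) + d - 1 = 2 * q + d + 1"
    "2 * (q + 1) + d - 3 = 2 * q + d - 1" "4 * (q + 1) + 4 - d = 4 * q + 8 - d" by simp_all
  \<comment> \<open>Each polynomial factor becomes a single letter, so that the cancellation needs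
    no expansion of products.\<close>
  have gen: "(A * B * F * X / (C * D * E * d)) * ((Y * D) * Z / (2 * (V * X) * R)) =
     ((A * H) * Z / (2 * (E * W) * R)) * (B * Y * F * W / (H * C * V * d))"
    if "X \<noteq> 0" "W \<noteq> 0" "D \<noteq> 0" "H \<noteq> 0" for A B F X C D E Y Z V R H W :: rat
    using that by (simp add: divide_simps) 
  show ?case
    unfolding wz_term_Suc Suc.IH of_nat_Suc q_def[symmetric] add.commute[of 1 q] e s mult.assoc[of "wz_term (d\<^sup>2) k"]
    by (subst gen) (use pos in auto)
qed

text \<open>The WZ pair: \<open>G\<close> is the term times a rational certificate. Dividing the
  deformed summands by \<open>d\<close> and \<open>d - 4\<close> normalises the sums to signs, which
  agree for \<open>d\<close> and \<open>d - 4\<close>.\<close>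

lemma wz_certificate:
  fixes n k :: nat
  assumes "odd n" "n \<ge> 5"
  defines "d \<equiv> of_nat n :: rat"
  defines "G \<equiv> \<lambda>k. - 8 * of_nat k * (2 * of_nat k - 1) * (4 * of_nat k + d) /
     (d * (2 * of_nat k + d - 1) * (2 * of_nat k + d - 3)) * wz_term (d\<^sup>2) k"
  shows "(6 * of_nat k + 1) * wz_term (d\<^sup>2) k / d - (6 * of_nat k + 1) * wz_term ((d - 4)\<^sup>2) k / (d - 4)
    = G (Suc k) - G k"
proof -
  have d: "d \<ge> 5" using assms by simp
  define q :: rat where "q = of_nat k"
  have q: "q \<ge> 0" by (simp add: q_def)
  have nz: "4 * q + 4 - d \<noteq> 0"
    using odd_neq_4_mult[OF assms(1), of "k + 1"] by (simp_all add: d_def q_def)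
  have pos: "2 * q + d - 1 \<noteq> 0" "2 * q + d - 3 \<noteq> 0" "2 * q + d + 1 \<noteq> 0" "d \<noteq> 0" "q + 1 \<noteq> 0"
    "4 * q + 4 + d \<noteq> 0" "d - 4 \<noteq> 0" using d q by auto
  define w where "w = wz_term (d\<^sup>2) k"
  \<comment> \<open>A common denominator of all four terms, each of which is \<open>w / L\<close>
    times a polynomial; what remains is a polynomial identity in \<open>q\<close> and
    \<open>d\<close>.\<close>
  define L where "L = d * (2 * q + d - 1) * (2 * q + d - 3) * (4 * q + 4 - d)"
  have L: "L \<noteq> 0" using pos nz by (simp add: L_def)
  have 1: "(6 * q + 1) * wz_term (d\<^sup>2) k / d =
     w * ((6 * q + 1) * (2 * q + d - 1) * (2 * q + d - 3) * (4 * q + 4 - d)) / L"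
    using pos nz by (simp add: L_def w_def)
  have 2: "(6 * q + 1) * wz_term ((d - 4)\<^sup>2) k / (d - 4) =
     - (w * ((6 * q + 1) * (2 * q - d + 1) * (2 * q - d + 3) * (4 * q + d))) / L"
    unfolding d_def wz_term_shift[OF assms(1,2)] unfolding d_def[symmetric] q_def[symmetric] 
    using pos nz L by (simp add: L_def w_def divide_simps) (simp add: algebra_simps)
  have e: "16 * (q + 1)\<^sup>2 - d\<^sup>2 = (4 * q + 4 - d) * (4 * q + 4 + d)"
    "(2 * q + 1)\<^sup>2 - d\<^sup>2 = (2 * q - d + 1) * (2 * q + d + 1)"
    by (simp_all add: algebra_simps power2_eq_square)
  have s: "2 * (q + 1) - 1 = 2 * q + 1" "4 * (q + 1) + d = 4 * q + 4 + d"
    "2 * (q + 1) + d - 1 = 2 * q + d + 1" "2 * (q + 1) + d - 3 = 2 * q + d - 1" by simp_all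
  have gen: "- 8 * R * Z * X / (d * A * B) * (w * ((C * A) * Z / (2 * (E * X) * R))) =
     w * (- 4 * Z * Z * C * F) / (d * B * F * E)"
    if "X \<noteq> 0" "R \<noteq> 0" "A \<noteq> 0" "F \<noteq> 0" for R Z X A B C E F
    using that by (simp add: divide_simps) 
  have 3: "G (Suc k) = w * (- 4 * (2 * q + 1) * (2 * q + 1) * (2 * q - d + 1) * (2 * q + d - 3)) / L"
    unfolding G_def wz_term_Suc of_nat_Suc q_def[symmetric] w_def[symmetric] add.commute[of 1 q] e s L_def
    by (rule gen) (use pos in auto)
  have 4: "G k = w * (- 8 * q * (2 * q - 1) * (4 * q + d) * (4 * q + 4 - d)) / L"
    unfolding G_def q_def[symmetric] w_def[symmetric] using pos nz by (simp add: L_def mult_ac)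
  show ?thesis unfolding q_def[symmetric] 1 2 3 4 diff_divide_distrib[symmetric]
    by (simp add: L) (simp add: algebra_simps)
qed

lemma wz_sum:
  assumes "j \<le> N"
  shows "(\<Sum>k\<le>N. (6 * of_nat k + 1) * wz_term ((2 * of_nat j + 1)\<^sup>2) k) = (- 1) ^ j * (2 * of_nat j + 1)"
  using assms
proof (induction j rule: less_induct)
  case (less j)
  have reduce: "(\<Sum>k\<le>N. (6 * of_nat k + 1) * wz_term ((2 * of_nat j + 1)\<^sup>2) k) =
      (\<Sum>k\<le>j. (6 * of_nat k + 1) * wz_term ((2 * of_nat j + 1)\<^sup>2) k)"
    by (rule sum.mono_neutral_right) (use less.prems wz_term_eq_0[of j] in auto)
  \<comment> \<open>A step of 4 in \<open>a\<close> is a step of 2 in \<open>j\<close>, hence two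
    base cases. Their sums are \<open>1\<close> and \<open>1 + 7 * (-4/7) = -3\<close>.\<close>
  consider "j = 0" | "j = 1" | i where "j = i + 2"
    by (metis One_nat_def add_2_eq_Suc' not0_implies_Suc)
  thus ?case
  proof cases
    case 1
    thus ?thesis unfolding reduce by simp
  next
    case 2
    thus ?thesis unfolding reduce by (simp add: wz_term_def)
  next
    case (3 i)
    define d :: rat where "d = of_nat (2 * j + 1)"
    define G where "G = (\<lambda>k. - 8 * of_nat k * (2 * of_nat k - 1) * (4 * of_nat k + d) /
     (d * (2 * of_nat k + d - 1) * (2 * of_nat k + d - 3)) * wz_term (d\<^sup>2) k)"
    have d4: "d - 4 = 2 * of_nat i + 1" "d = 2 * of_nat j + 1" by (simp_all add: d_def 3)
    have "d \<noteq> 0" by (simp add: d_def add_nonneg_eq_0_iff)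
    moreover have "d - 4 \<noteq> 0" unfolding d4(1) by (simp add: add_nonneg_eq_0_iff)
    ultimately have nz: "d \<noteq> 0" "d - 4 \<noteq> 0" by blast+
    have "(\<Sum>k\<le>N. (6 * of_nat k + 1) * wz_term (d\<^sup>2) k / d -
        (6 * of_nat k + 1) * wz_term ((d - 4)\<^sup>2) k / (d - 4)) = (\<Sum>k\<le>N. G (Suc k) - G k)"
      unfolding G_def d_def using 3 by (intro sum.cong refl wz_certificate) auto
    also have "\<dots> = G (Suc N) - G 0"
      unfolding lessThan_Suc_atMost[symmetric] by (rule sum_lessThan_telescope)
    \<comment> \<open>\<open>G 0\<close> vanishes through its factor \<open>k\<close>, and
      \<open>G (Suc N)\<close> because the series has terminated: \<open>j < Suc N\<close>.\<close>
    also have "\<dots> = 0" using wz_term_eq_0[of j "Suc N"] less.prems by (simp add: G_def d4(2))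
    finally have "(\<Sum>k\<le>N. (6 * of_nat k + 1) * wz_term (d\<^sup>2) k) / d =
        (\<Sum>k\<le>N. (6 * of_nat k + 1) * wz_term ((d - 4)\<^sup>2) k) / (d - 4)"
      by (simp add: sum_subtractf sum_divide_distrib)
    also have "\<dots> = (- 1) ^ i"
      using less.IH[of i] less.prems nz 3 by (simp add: d4(1))
    finally show ?thesis using nz by (simp add: d4(2) 3 field_simps)
  qed
qed

section \<open>Interpolation at odd squares\<close>

lemma lagrange_interpolation:
  fixes P :: "'a :: field poly" and x :: "'b \<Rightarrow> 'a"
  assumes "finite A" "inj_on x A" "degree P < card A"
  shows "poly P z = (\<Sum>j\<in>A. poly P (x j) * (\<Prod>i\<in>A - {j}. (z - x i) / (x j - x i)))"
proof -
  define L where "L = (\<lambda>j. \<Prod>i\<in>A - {j}. smult (1 / (x j - x i)) [:- x i, 1:])"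
  have L: "poly (L j) z = (\<Prod>i\<in>A - {j}. (z - x i) / (x j - x i))" for j z
    by (simp add: L_def poly_prod diff_divide_distrib)
  define R where "R = (\<Sum>j\<in>A. smult (poly P (x j)) (L j))"
  have deg: "degree (L j) < card A" if "j \<in> A" for j
  proof -
    have "degree (L j) \<le> (\<Sum>i\<in>A - {j}. degree (smult (1 / (x j - x i)) [:- x i, 1:]))"
      unfolding L_def using assms(1) by (intro degree_prod_sum_le[unfolded comp_def]) auto
    also have "\<dots> \<le> (\<Sum>i\<in>A - {j}. 1)" by (intro sum_mono) auto
    also have "\<dots> < card A" using assms(1) that
      by simp (metis assms(1) card_gt_0_iff empty_iff diff_Suc_less)
    finally show ?thesis .
  qed
  have "P = R"
  proof (rule poly_eqI_degree)
    fix y assume "y \<in> x ` A"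
    then obtain k where k: "k \<in> A" "y = x k" by auto
    have "poly (L j) (x k) = (if j = k then 1 else 0)" if "j \<in> A" for j
    proof (cases "j = k")
      case True
      moreover have "x k - x i \<noteq> 0" if "i \<in> A - {k}" for i
        using that k assms(2) by (auto simp: inj_on_def)
      ultimately show ?thesis unfolding L by (simp add: prod.neutral)
    next
      case False
      thus ?thesis using k assms(1) unfolding L by (auto intro!: prod_zero)
    qed
    hence "poly R (x k) = (\<Sum>j\<in>A. poly P (x j) * (if j = k then 1 else 0))"
      unfolding R_def poly_sum by (intro sum.cong) auto
    thus "poly P y = poly R y" using k assms(1) by (simp add: if_distrib sum.delta cong: if_cong)
  next
    show "degree P < card (x ` A)" using assms by (simp add: card_image)
    have "degree R < card A" unfolding R_def
      by (intro degree_sum_less) (use assms deg in \<open>auto simp: degree_smult_eq\<close>)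
    thus "degree R < card (x ` A)" using assms by (simp add: card_image)
  qed
  hence "poly P z = poly R z" by simp
  thus ?thesis by (simp add: R_def poly_sum L)
qed

text \<open>Truncation of Euler's product for \<open>sin(pi a / 4) / (pi a / 4)\<close> at
  \<open>x = a^2\<close>. Its zeros are exactly the poles of the terms up to index \<open>N\<close>,
  so it clears their denominators.\<close>

definition sine_prod :: "nat \<Rightarrow> rat \<Rightarrow> rat" where
  "sine_prod N x = (\<Prod>i = 1..N. 1 - x / (16 * (of_nat i)\<^sup>2))"

definition node :: "nat \<Rightarrow> rat" where
  "node j = (2 * of_nat j + 1)\<^sup>2"

lemma node_eq_iff: "node i = node j \<longleftrightarrow> i = j"
proof -
  have "node k = of_nat ((2 * k + 1)\<^sup>2)" for k by (simp add: node_def)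
  thus ?thesis by (simp only: of_nat_eq_iff) simp
qed

lemma node_neq: "16 * (of_nat i)\<^sup>2 \<noteq> node j"
proof
  assume "16 * (of_nat i)\<^sup>2 = node j"
  hence "(of_nat (16 * i\<^sup>2) :: rat) = of_nat ((2 * j + 1)\<^sup>2)" by (simp add: node_def)
  hence "16 * i\<^sup>2 = (2 * j + 1)\<^sup>2" by (simp only: of_nat_eq_iff)
  hence "even ((2 * j + 1)\<^sup>2)" by (metis even_mult_iff even_numeral)
  thus False by simp
qed

lemma sine_prod_wz_term:
  assumes "k \<le> N" "\<And>i. x \<noteq> 16 * (of_nat (Suc i))\<^sup>2"
  shows "sine_prod N x * wz_term x k =
    (\<Prod>i<k. (2 * of_nat i + 1) / (32 * (of_nat (Suc i)) ^ 3) * ((2 * of_nat i + 1)\<^sup>2 - x)) *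
    (\<Prod>i=k..<N. 1 - x / (16 * (of_nat (Suc i))\<^sup>2))"
proof -
  let ?f = "\<lambda>i. 1 - x / (16 * (of_nat (Suc i))\<^sup>2)"
  have "sine_prod N x = (\<Prod>i\<in>{0..<N}. ?f i)"
    unfolding sine_prod_def One_nat_def prod.atLeast1_atMost_eq lessThan_atLeast0 by simp
  also have "\<dots> = (\<Prod>i\<in>{0..<k}. ?f i) * (\<Prod>i=k..<N. ?f i)"
    using assms(1) by (simp add: prod.atLeastLessThan_concat)
  finally have 1: "sine_prod N x = (\<Prod>i<k. ?f i) * (\<Prod>i=k..<N. ?f i)" by (simp add: lessThan_atLeast0)
  have "(1 - x / (16 * s\<^sup>2)) * (C * r / (2 * (16 * s\<^sup>2 - x) * s)) = r / (32 * s ^ 3) * C"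
    if "x \<noteq> 16 * s\<^sup>2" "s \<noteq> 0" for s C r :: rat
  proof -
    have *: "1 - x / (16 * s\<^sup>2) = (16 * s\<^sup>2 - x) / (16 * s\<^sup>2)" using that by (simp add: field_simps)
    have "v / (16 * s\<^sup>2) * (C * r / (2 * v * s)) = r / (32 * s ^ 3) * C" if "v \<noteq> 0" for v
      using that by (simp add: power2_eq_square power3_eq_cube mult_ac)
    from this[of "16 * s\<^sup>2 - x"] show ?thesis unfolding * using that(1) by (metis right_minus_eq)
  qed
  hence 2: "?f i * (((2 * of_nat i + 1)\<^sup>2 - x) * (2 * of_nat i + 1) /
     (2 * (16 * (of_nat (Suc i))\<^sup>2 - x) * (of_nat (Suc i)))) =
      (2 * of_nat i + 1) / (32 * (of_nat (Suc i)) ^ 3) * ((2 * of_nat i + 1)\<^sup>2 - x)" for i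
    using assms(2)[of i] by (metis of_nat_neq_0)
  have "wz_term x k = (\<Prod>i<k. ((2 * of_nat i + 1)\<^sup>2 - x) * (2 * of_nat i + 1) /
     (2 * (16 * (of_nat (Suc i))\<^sup>2 - x) * (of_nat (Suc i))))"
    by (simp add: wz_term_def add.commute)
  hence "(\<Prod>i<k. ?f i) * wz_term x k = (\<Prod>i<k. (2 * of_nat i + 1) / (32 * (of_nat (Suc i)) ^ 3) * ((2 * of_nat i + 1)\<^sup>2 - x))"
    by (simp only: prod.distrib[symmetric] 2)
  moreover have "a * b * w = c * b" if "a * w = c" for a b c w :: rat using that by auto
  ultimately show ?thesis unfolding 1 by blast
qed

text \<open>The cleared sum is a polynomial of degree at most \<open>N\<close>, and
  \<open>wz_sum\<close> gives its values at \<open>N + 1\<close> odd squares. Its value at 0 is the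
  undeformed sum, since \<open>sine_prod N 0 = 1\<close>.\<close>

lemma interpolated_sum:
  "(\<Sum>k\<le>N. (6 * of_nat k + 1) * wz_term 0 k) =
   (\<Sum>j\<le>N. (- 1) ^ j * (2 * of_nat j + 1) * sine_prod N (node j) *
     (\<Prod>i\<in>{..N} - {j}. node i / (node i - node j)))"
proof -
  define P :: "rat poly" where "P = (\<Sum>k\<le>N. smult (6 * of_nat k + 1)
    ((\<Prod>i<k. smult ((2 * of_nat i + 1) / (32 * (of_nat (Suc i)) ^ 3)) [:(2 * of_nat i + 1)\<^sup>2, -1:]) *
    (\<Prod>i=k..<N. [:1, - 1 / (16 * (of_nat (Suc i))\<^sup>2):])))"
  have poly_P: "poly P x = sine_prod N x * (\<Sum>k\<le>N. (6 * of_nat k + 1) * wz_term x k)"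
    if "\<And>i. x \<noteq> 16 * (of_nat (Suc i))\<^sup>2" for x
  proof -
    have "poly P x = (\<Sum>k\<le>N. (6 * of_nat k + 1) * (sine_prod N x * wz_term x k))"
      unfolding P_def poly_sum
    proof (rule sum.cong)
      fix k assume "k \<in> {..N}"
      hence "k \<le> N" by simp
      have "poly (smult c [:a, - 1:]) x = c * (a - x)" "poly [:1, - 1 / u:] x = 1 - x / u" for a c u
        by (simp_all add: algebra_simps)
      thus "poly (smult (6 * of_nat k + 1)
          ((\<Prod>i<k. smult ((2 * of_nat i + 1) / (32 * (of_nat (Suc i)) ^ 3)) [:(2 * of_nat i + 1)\<^sup>2, -1:]) *
          (\<Prod>i=k..<N. [:1, - 1 / (16 * (of_nat (Suc i))\<^sup>2):]))) x =
        (6 * of_nat k + 1) * (sine_prod N x * wz_term x k)"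
        unfolding sine_prod_wz_term[OF \<open>k \<le> N\<close> that]
        by (simp only: poly_smult[of "6 * of_nat k + 1"] poly_mult poly_prod)
    qed simp
    thus ?thesis by (simp add: sum_distrib_left mult_ac)
  qed
  have "degree P < card {..N}"
    unfolding P_def
  proof (rule degree_sum_less)
    fix k assume k: "k \<in> {..N}"
    have "degree ((\<Prod>i<k. smult ((2 * of_nat i + 1) / (32 * (of_nat (Suc i)) ^ 3)) [:(2 * of_nat i + 1)\<^sup>2, -1::rat:])) \<le> (\<Sum>i<k. 1)"
      by (rule order.trans[OF degree_prod_sum_le[unfolded comp_def] sum_mono]) auto
    moreover have "degree (\<Prod>i=k..<N. [:1, - 1 / (16 * (of_nat (Suc i))\<^sup>2) :: rat:]) \<le> (\<Sum>i=k..<N. 1)"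
      by (rule order.trans[OF degree_prod_sum_le[unfolded comp_def] sum_mono]) auto
    ultimately show "degree (smult (6 * of_nat k + 1)
    ((\<Prod>i<k. smult ((2 * of_nat i + 1) / (32 * (of_nat (Suc i)) ^ 3)) [:(2 * of_nat i + 1)\<^sup>2, -1:]) *
    (\<Prod>i=k..<N. [:1, - 1 / (16 * (of_nat (Suc i))\<^sup>2):])) :: rat poly) < card {..N}"
      using k by (intro le_less_trans[OF degree_smult_le] le_less_trans[OF degree_mult_le]) auto
  qed simp
  hence "poly P 0 = (\<Sum>j\<le>N. poly P (node j) * (\<Prod>i\<in>{..N} - {j}. (0 - node i) / (node j - node i)))"
    by (intro lagrange_interpolation) (auto simp: inj_on_def node_eq_iff)
  also have "\<dots> = (\<Sum>j\<le>N. (- 1) ^ j * (2 * of_nat j + 1) * sine_prod N (node j) *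
     (\<Prod>i\<in>{..N} - {j}. node i / (node i - node j)))"
  proof (rule sum.cong)
    fix j assume "j \<in> {..N}"
    hence "poly P (node j) = (- 1) ^ j * (2 * of_nat j + 1) * sine_prod N (node j)"
      using wz_sum[of j N] by (subst poly_P[OF node_neq[symmetric]]) (auto simp: node_def)
    moreover have "(0 - node i) / (node j - node i) = node i / (node i - node j)" for i
      by (metis diff_0 minus_diff_eq minus_divide_divide)
    ultimately show "poly P (node j) * (\<Prod>i\<in>{..N} - {j}. (0 - node i) / (node j - node i)) =
      (- 1) ^ j * (2 * of_nat j + 1) * sine_prod N (node j) *
     (\<Prod>i\<in>{..N} - {j}. node i / (node i - node j))" by simp
  qed simp
  finally show ?thesis by (subst (asm) poly_P) (auto simp: sine_prod_def)
qed

section \<open>Closed form of the interpolation weights\<close>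

lemma node_diff: "node i - node j = 4 * (of_nat i - of_nat j) * (of_nat i + of_nat j + 1)"
  by (simp add: node_def power2_eq_square algebra_simps)

lemma binomial_skip_Suc:
  assumes "j \<le> N"
  shows "(of_nat ((2 * Suc N + 1) choose (Suc N - j)) :: rat) = of_nat ((2 * N + 1) choose (N - j)) *
    ((2 * of_nat N + 3) * (2 * of_nat N + 2) / ((of_nat N + 1 - of_nat j) * (of_nat N + of_nat j + 2)))"
proof -
  have 1: "2 * N + 1 - (N - j) = N + j + 1" "2 * Suc N + 1 - (Suc N - j) = Suc (N + j + 1)"
    "Suc N - j = Suc (N - j)" using assms by simp_all
  have "F * u * v / ((s * f) * (r * g)) = F / (f * g) * (u * v / (s * r))" for F u v s r f g :: rat
    by (simp add: mult_ac)
  moreover have "(fact (2 * Suc N + 1) :: rat) = fact (2 * N + 1) * (2 * of_nat N + 3) * (2 * of_nat N + 2)"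
    by (simp add: algebra_simps)
  moreover have "(fact (Suc N - j) :: rat) = (of_nat N + 1 - of_nat j) * fact (N - j)"
    using assms unfolding 1(3) by (simp add: of_nat_diff algebra_simps)
  moreover have "(fact (Suc (N + j + 1)) :: rat) = (of_nat N + of_nat j + 2) * fact (N + j + 1)"
    unfolding fact_Suc by (simp add: algebra_simps)
  moreover have "Suc N - j \<le> 2 * Suc N + 1" "N - j \<le> 2 * N + 1" by simp_all
  ultimately show ?thesis by (simp only: binomial_fact 1(1,2))
qed

lemma fact_double: "(fact (2 * n) :: rat) = 2 ^ n * fact n * (\<Prod>i<n. 2 * of_nat i + 1)"
  by (induction n) (simp_all add: algebra_simps)

lemma fact_add_prod: "(fact (k + n) :: rat) = fact k * (\<Prod>i<n. of_nat k + of_nat i + 1)"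
  by (induction n) (simp_all add: algebra_simps)

lemma power_4_mult_power_2: "(4 :: rat) ^ n * (2 ^ n) ^ 2 = 16 ^ n"
  by (induction n) (simp_all add: power_mult_distrib)

text \<open>By \<open>node_diff\<close> the denominators split into \<open>j - i\<close> and
  \<open>j + i + 1\<close>, whose products are factorials; the numerators give the square of an odd
  double factorial.\<close>

lemma interpolation_weight_diag:
  "(\<Prod>i<j. node i / (node j - node i)) = of_nat ((2 * j) choose j) / 16 ^ j"
proof -
  have f2: "(fact (2 * j) :: rat) = fact j * (\<Prod>i<j. of_nat j + of_nat i + 1)"
    using fact_add_prod[of j j] by (simp add: mult_2)
  have f3: "(\<Prod>i<j. of_nat j - of_nat i) = (fact j :: rat)"
    by (simp add: fact_prod_rev of_nat_prod lessThan_atLeast0 of_nat_diff)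
  have "(\<Prod>i<j. node i / (node j - node i)) =
     (\<Prod>i<j. 2 * of_nat i + 1) ^ 2 / (4 ^ j * (\<Prod>i<j. of_nat j - of_nat i) * (\<Prod>i<j. of_nat j + of_nat i + 1))"
    unfolding node_diff prod_dividef prod.distrib by (simp add: node_def prod_power_distrib)
  also have "\<dots> = (fact (2 * j) / (2 ^ j * fact j)) ^ 2 / (4 ^ j * fact j * (fact (2 * j) / fact j))"
    unfolding f3 using fact_double[of j] f2 by simp
  also have "\<dots> = fact (2 * j) / (fact j * fact j) / (4 ^ j * (2 ^ j) ^ 2)"
    by (simp add: power2_eq_square)
  also have "(4 :: rat) ^ j * (2 ^ j) ^ 2 = 16 ^ j" by (rule power_4_mult_power_2)
  finally show ?thesis by (simp add: binomial_fact)
qed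

text \<open>Induction on \<open>N\<close> with \<open>j\<close> fixed: the one new factor
  \<open>node (Suc N) / (node (Suc N) - node j)\<close> matches the growth of the two binomial
  coefficients. The sign \<open>(- 1) ^ j\<close> cancels against the \<open>j\<close> nodes below
  \<open>node j\<close>, so the interpolated sum is no longer alternating.\<close>

lemma interpolation_weight:
  assumes "j \<le> N"
  shows "(- 1) ^ j * (2 * of_nat j + 1) * (\<Prod>i\<in>{..N} - {j}. node i / (node i - node j)) =
    (2 * of_nat N + 1) * of_nat ((2 * N) choose N) / 16 ^ N * of_nat ((2 * N + 1) choose (N - j))"
  using assms
proof (induction N rule: dec_induct)
  case base
  have "(\<Prod>i\<in>{..j} - {j}. node i / (node i - node j)) = (\<Prod>i<j. (- 1) * (node i / (node j - node i)))"
    by (rule prod.cong) (auto simp: minus_divide_right)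
  also have "\<dots> = (- 1) ^ j * (\<Prod>i<j. node i / (node j - node i))"
    by (simp only: prod.distrib) simp
  finally show ?case unfolding interpolation_weight_diag by simp
next
  case (step n)
  have "{..Suc n} - {j} = insert (Suc n) ({..n} - {j})" using step by auto
  hence "(\<Prod>i\<in>{..Suc n} - {j}. node i / (node i - node j)) =
      node (Suc n) / (node (Suc n) - node j) * (\<Prod>i\<in>{..n} - {j}. node i / (node i - node j))" by simp
  hence 1: "(- 1) ^ j * (2 * of_nat j + 1) * (\<Prod>i\<in>{..Suc n} - {j}. node i / (node i - node j)) =
     (2 * of_nat n + 1) * of_nat ((2 * n) choose n) / 16 ^ n * of_nat ((2 * n + 1) choose (n - j)) *
      (node (Suc n) / (node (Suc n) - node j))"
    unfolding step.IH[symmetric] by simp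
  \<comment> \<open>Here \<open>u = 2 n + 3\<close>, \<open>v = n + 1 - j\<close>,
    \<open>w = n + j + 2\<close> and \<open>s = n + 1\<close>; the factor \<open>s\<close> cancels
    between the growth of the two binomial coefficients.\<close>
  have gen: "a * b / e * c * (u\<^sup>2 / (4 * v * w)) = u * (2 * a * b / s) / (16 * e) * (c * (u * (2 * s) / (v * w)))"
    if "s \<noteq> 0" for a b e c u v w s :: rat using that by (simp add: power2_eq_square)
  have r: "node (Suc n) / (node (Suc n) - node j) = (2 * of_nat n + 3)\<^sup>2 / (4 * (of_nat n + 1 - of_nat j) * (of_nat n + of_nat j + 2))"
    "2 * of_nat (Suc n) + (1 :: rat) = 2 * of_nat n + 3" "2 * of_nat n + (2 :: rat) = 2 * (of_nat n + 1)"
    unfolding node_diff by (simp_all add: node_def add_ac diff_add_eq)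
  show ?case unfolding 1 binomial_skip_Suc[OF step.hyps(1)] central_binomial_Suc power_Suc r
    by (rule gen) (simp add: add_nonneg_eq_0_iff)
qed

lemma ramanujan_sum_eq:
  "(\<Sum>k\<le>N. (6 * of_nat k + 1) * wz_term 0 k) =
   (2 * of_nat N + 1) * of_nat ((2 * N) choose N) / 16 ^ N *
   (\<Sum>j\<le>N. of_nat ((2 * N + 1) choose (N - j)) * sine_prod N (node j))"
proof -
  have "(- 1) ^ j * (2 * of_nat j + 1) * sine_prod N (node j) * (\<Prod>i\<in>{..N} - {j}. node i / (node i - node j))
     = (2 * of_nat N + 1) * of_nat ((2 * N) choose N) / 16 ^ N *
       (of_nat ((2 * N + 1) choose (N - j)) * sine_prod N (node j))" if "j \<le> N" for j
  proof -
    have "a * b * q * w = c * (d * q)" if "a * b * w = c * d" for a b q w c d :: rat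
      using that by (metis mult.assoc mult.commute)
    from this[OF interpolation_weight[OF that]] show ?thesis .
  qed
  thus ?thesis unfolding interpolated_sum sum_distrib_left by (intro sum.cong) auto
qed

text \<open>As \<open>2 N + 1\<close> is odd, the reflection swaps even with odd indices and the
  lower with the upper half, so both sides are half of the full sum. Even indices are wanted because
  the arguments of \<open>sine_prod\<close> then move in steps of 4.\<close>

lemma sum_even_reflect:
  fixes f :: "nat \<Rightarrow> rat"
  assumes "\<And>M. M \<le> 2 * N + 1 \<Longrightarrow> f (2 * N + 1 - M) = f M"
  shows "(\<Sum>j\<le>N. f (N - j)) = (\<Sum>m\<le>N. f (2 * m))"
proof -
  have r: "(\<Sum>j\<le>N. g (N - j)) = (\<Sum>j\<le>N. g j)" for g :: "nat \<Rightarrow> rat"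
    by (rule sum.nat_diff_reindex[of _ "Suc N", unfolded lessThan_Suc_atMost, simplified])
  have "(\<Sum>M\<le>2 * n + 1. f M) = (\<Sum>j\<le>n. f (2 * j)) + (\<Sum>j\<le>n. f (2 * j + 1))" for n
  proof (induction n)
    case (Suc n)
    have e: "2 * Suc n + 1 = Suc (Suc (2 * n + 1))" by simp
    have "(\<Sum>M\<le>2 * Suc n + 1. f M) = (\<Sum>M\<le>2 * n + 1. f M) + f (Suc (2 * n + 1)) + f (Suc (Suc (2 * n + 1)))"
      unfolding e sum.atMost_Suc ..
    thus ?case unfolding Suc.IH sum.atMost_Suc by simp
  qed simp
  hence "(\<Sum>M\<le>2 * N + 1. f M) = (\<Sum>j\<le>N. f (2 * j)) + (\<Sum>j\<le>N. f (2 * j + 1))" .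
  also have "(\<Sum>j\<le>N. f (2 * j + 1)) = (\<Sum>j\<le>N. f (2 * (N - j)))"
  proof (rule sum.cong)
    fix j assume "j \<in> {..N}"
    hence "f (2 * N + 1 - (2 * j + 1)) = f (2 * j + 1)" and "2 * N + 1 - (2 * j + 1) = 2 * (N - j)"
      using assms[of "2 * j + 1"] by simp_all
    thus "f (2 * j + 1) = f (2 * (N - j))" by simp
  qed simp
  also have "\<dots> = (\<Sum>j\<le>N. f (2 * j))" by (rule r)
  finally have 1: "(\<Sum>M\<le>2 * N + 1. f M) = 2 * (\<Sum>j\<le>N. f (2 * j))" by simp
  have "{..2 * N + 1} = {..N} \<union> {N + 1..2 * N + 1}" by auto
  hence "(\<Sum>M\<le>2 * N + 1. f M) = (\<Sum>j\<le>N. f j) + (\<Sum>j=N + 1..2 * N + 1. f j)"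
    by (simp only:) (rule sum.union_disjoint, auto)
  also have "(\<Sum>j=N + 1..2 * N + 1. f j) = (\<Sum>j\<le>N. f (2 * N + 1 - j))"
    by (rule sum.reindex_bij_witness[of _ "\<lambda>j. 2 * N + 1 - j" "\<lambda>j. 2 * N + 1 - j"]) auto
  also have "\<dots> = (\<Sum>j\<le>N. f j)" using assms by (intro sum.cong) auto
  finally show ?thesis using 1 r[of f] by simp
qed

section \<open>Even-indexed form and the truncated sine product along steps of 4\<close>

lemma ramanujan_sum_eq_even:
  "(\<Sum>k\<le>N. (6 * of_nat k + 1) * wz_term 0 k) =
   of_nat (2 * N + 1) * (of_nat ((2 * N) choose N) / 16 ^ N) *
   (\<Sum>m\<le>N. of_nat ((2 * N + 1) choose (2 * m)) *
      sine_prod N ((of_nat (2 * N + 1) - 4 * of_nat m)\<^sup>2))"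
proof -
  define f :: "nat \<Rightarrow> rat" where "f = (\<lambda>M. of_nat ((2 * N + 1) choose M) *
      sine_prod N ((of_nat (2 * N + 1) - 2 * of_nat M)\<^sup>2))"
  have "f (2 * N + 1 - M) = f M" if "M \<le> 2 * N + 1" for M
  proof -
    have "(of_nat (2 * N + 1) - 2 * of_nat (2 * N + 1 - M) :: rat) = - (of_nat (2 * N + 1) - 2 * of_nat M)"
      unfolding of_nat_diff[OF that] by simp
    moreover have "(2 * N + 1) choose (2 * N + 1 - M) = (2 * N + 1) choose M"
      using binomial_symmetric[OF that] by simp
    ultimately show ?thesis unfolding f_def by (simp only: power2_minus)
  qed
  hence "(\<Sum>j\<le>N. f (N - j)) = (\<Sum>m\<le>N. f (2 * m))" by (rule sum_even_reflect)
  moreover have "f (N - j) = of_nat ((2 * N + 1) choose (N - j)) * sine_prod N (node j)" if "j \<le> N" for j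
  proof -
    have "(of_nat (2 * N + 1) - 2 * of_nat (N - j) :: rat) = 2 * of_nat j + 1"
      unfolding of_nat_diff[OF that] by simp
    thus ?thesis by (simp only: f_def node_def)
  qed
  ultimately have "(\<Sum>j\<le>N. of_nat ((2 * N + 1) choose (N - j)) * sine_prod N (node j)) = (\<Sum>m\<le>N. f (2 * m))"
    by (simp cong: sum.cong_simp)
  moreover have "f (2 * m) = of_nat ((2 * N + 1) choose (2 * m)) *
      sine_prod N ((of_nat (2 * N + 1) - 4 * of_nat m)\<^sup>2)" for m
    by (simp add: f_def)
  moreover have "2 * of_nat N + 1 = (of_nat (2 * N + 1) :: rat)" by simp
  ultimately show ?thesis by (simp only: ramanujan_sum_eq times_divide_eq_right)
qed

text \<open>A finite form of \<open>sin(y - pi) = - sin y\<close>: the shift moves the families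
  \<open>4 i - x\<close> and \<open>4 i + x\<close> by one index each. The identity is
  cross-multiplied so that it holds for every \<open>x\<close>.\<close>

lemma sine_prod_shift:
  "sine_prod N ((x - 4)\<^sup>2) * ((4 - x) * (4 * of_nat N + x)) =
   sine_prod N (x\<^sup>2) * ((4 * of_nat N + 4 - x) * x)"
proof (induction N)
  case (Suc N)
  define s :: rat where "s = of_nat (Suc N)"
  have s: "s \<noteq> 0" "of_nat N = s - 1" by (simp_all add: s_def)
  have "1 - y\<^sup>2 / (16 * s\<^sup>2) = (4 * s - y) * (4 * s + y) / (16 * s\<^sup>2)" for y
    using s by (simp add: field_simps power2_eq_square)
  hence e: "sine_prod (Suc N) (y\<^sup>2) = sine_prod N (y\<^sup>2) * ((4 * s - y) * (4 * s + y) / (16 * s\<^sup>2))" for y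
    by (simp add: sine_prod_def s_def del: of_nat_Suc)
  have IH: "sine_prod N ((x - 4)\<^sup>2) * ((4 - x) * (4 * s + x - 4)) = sine_prod N (x\<^sup>2) * ((4 * s - x) * x)"
    using Suc.IH unfolding s by (simp add: algebra_simps)
  have "sine_prod (Suc N) ((x - 4)\<^sup>2) * ((4 - x) * (4 * s + x)) =
     (sine_prod N ((x - 4)\<^sup>2) * ((4 - x) * (4 * s + x - 4))) * ((4 * s + 4 - x) * (4 * s + x) / (16 * s\<^sup>2))"
    unfolding e by (simp add: mult_ac diff_diff_eq2 add_diff_eq)
  also have "\<dots> = sine_prod (Suc N) (x\<^sup>2) * ((4 * s + 4 - x) * x)"
    unfolding IH e by (simp add: mult_ac)
  finally show ?case by (simp only: s_def)
qed (simp add: sine_prod_def)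

text \<open>Iteration of \<open>sine_prod_shift\<close> from \<open>x = P\<close>. With
  \<open>4 N = 2 P - 2\<close> the boundary factors become \<open>P + 4 i + 2\<close> and
  \<open>4 i + 2 - 3 P\<close>, while the quotients \<open>x / (x - 4)\<close> telescope to
  \<open>P / (P - 4 m)\<close>.\<close>

lemma sine_prod_odd:
  fixes N m :: nat
  defines "P \<equiv> of_nat (2 * N + 1) :: rat"
  shows "sine_prod N ((P - 4 * of_nat m)\<^sup>2) = sine_prod N (P\<^sup>2) * (P / (P - 4 * of_nat m) *
    (\<Prod>i<m. (P + 4 * of_nat i + 2) / (4 * of_nat i + 2 - 3 * P)))"
proof (induction m)
  case 0
  have "P \<noteq> 0" unfolding P_def by (simp add: add_nonneg_eq_0_iff)
  thus ?case by simp
next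
  case (Suc m)
  define q :: rat where "q = of_nat m"
  have nz: "P - 4 * q \<noteq> 0" "P - 4 * (q + 1) \<noteq> 0"
    using odd_neq_4_mult[of "2 * N + 1" m] odd_neq_4_mult[of "2 * N + 1" "m + 1"]
    by (auto simp: P_def q_def)
  have nz2: "4 * q + 2 - 3 * P \<noteq> 0"
  proof
    assume "4 * q + 2 - 3 * P = 0"
    hence "of_nat (4 * m + 2) = (of_nat (3 * (2 * N + 1)) :: rat)" by (simp add: P_def q_def)
    hence "4 * m + 2 = 3 * (2 * N + 1)" by (simp only: of_nat_eq_iff)
    thus False by presburger
  qed
  have "4 - (P - 4 * q) = - (P - 4 * (q + 1))" "4 * of_nat N + (P - 4 * q) = - (4 * q + 2 - 3 * P)"
    "4 * of_nat N + 4 - (P - 4 * q) = P + 4 * q + 2" "P - 4 * q - 4 = P - 4 * (q + 1)"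
    by (simp_all add: P_def algebra_simps)
  with sine_prod_shift[of N "P - 4 * q"]
  have "sine_prod N ((P - 4 * (q + 1))\<^sup>2) * ((P - 4 * (q + 1)) * (4 * q + 2 - 3 * P)) =
    sine_prod N ((P - 4 * q)\<^sup>2) * ((P + 4 * q + 2) * (P - 4 * q))"
    by (simp only: minus_mult_minus)
  hence "sine_prod N ((P - 4 * (q + 1))\<^sup>2) =
    sine_prod N ((P - 4 * q)\<^sup>2) * ((P + 4 * q + 2) * (P - 4 * q)) / ((P - 4 * (q + 1)) * (4 * q + 2 - 3 * P))"
    using nz nz2 by (simp add: nonzero_eq_divide_eq)
  also have "sine_prod N ((P - 4 * q)\<^sup>2) * ((P + 4 * q + 2) * (P - 4 * q)) / ((P - 4 * (q + 1)) * (4 * q + 2 - 3 * P))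
     = sine_prod N (P\<^sup>2) * (P / (P - 4 * (q + 1)) *
    ((\<Prod>i<m. (P + 4 * of_nat i + 2) / (4 * of_nat i + 2 - 3 * P)) * ((P + 4 * q + 2) / (4 * q + 2 - 3 * P))))"
    unfolding q_def Suc.IH unfolding q_def[symmetric] using nz by simp
  finally show ?case by (simp add: q_def add.commute)
qed

text \<open>Each factor equals \<open>- (P - 2 i)^2 / (4 i (P - i))\<close>; here
  \<open>P - 2 i\<close> runs through the odd numbers below \<open>2 N\<close>, and
  \<open>P - i\<close> through \<open>N + 1, ..., 2 N\<close>. The form \<open>1 + P^2 y\<close>
  prepares a first-order expansion modulo the fourth power of \<open>P\<close>.\<close>

lemma central_binomial_prod:
  fixes N :: nat
  defines "P \<equiv> of_nat (2 * N + 1) :: rat"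
  shows "of_nat ((2 * N) choose N) / 16 ^ N = (- 1) ^ N * (\<Prod>i=1..N. 1 + P\<^sup>2 * (1 / (4 * of_nat i * (of_nat i - P))))"
proof -
  have 1: "(\<Prod>i=1..N. P - 2 * of_nat i) = fact (2 * N) / (2 ^ N * fact N)"
  proof -
    have "(\<Prod>i=1..N. P - 2 * of_nat i) = (\<Prod>i<N. 2 * of_nat i + 1)"
      by (rule prod.reindex_bij_witness[of _ "\<lambda>i. N - i" "\<lambda>i. N - i"]) (auto simp: P_def of_nat_diff)
    thus ?thesis using fact_double[of N] by simp
  qed
  have 2: "(\<Prod>i=1..N. P - of_nat i) = fact (2 * N) / fact N"
  proof -
    have "fact (2 * N) / fact N = (\<Prod>i<N. of_nat N + of_nat i + 1 :: rat)"
      using fact_add_prod[of N N] by (simp add: mult_2)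
    also have "\<dots> = (\<Prod>i=1..N. P - of_nat i)"
      by (rule prod.reindex_bij_witness[of _ "\<lambda>i. N - i" "\<lambda>i. N - i"]) (auto simp: P_def of_nat_diff)
    finally show ?thesis by simp
  qed
  have "1 + P\<^sup>2 * (1 / (4 * of_nat i * (of_nat i - P))) = (- 1) * ((P - 2 * of_nat i)\<^sup>2 / (4 * of_nat i * (P - of_nat i)))"
    if "i \<in> {1..N}" for i
  proof -
    have "(of_nat i :: rat) < P" using that unfolding P_def of_nat_less_iff by auto
    hence "of_nat i \<noteq> (0 :: rat)" "P - of_nat i \<noteq> 0" "of_nat i - P \<noteq> 0" using that by auto
    moreover have "(1 + P\<^sup>2 * (1 / (4 * s * (- u)))) = (- 1) * ((P\<^sup>2 - 4 * s * u) / (4 * s * u))"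
      if "s \<noteq> 0" "u \<noteq> 0" for s u using that by (simp add: field_simps)
    moreover have "P\<^sup>2 - 4 * of_nat i * (P - of_nat i) = (P - 2 * of_nat i)\<^sup>2"
      by (simp add: algebra_simps power2_eq_square)
    moreover have "of_nat i - P = - (P - of_nat i)" by simp
    ultimately show ?thesis by metis
  qed
  hence "(\<Prod>i=1..N. 1 + P\<^sup>2 * (1 / (4 * of_nat i * (of_nat i - P)))) =
     (\<Prod>i=1..N. (- 1) * ((P - 2 * of_nat i)\<^sup>2 / (4 * of_nat i * (P - of_nat i))))" by (rule prod.cong[OF refl])
  also have "\<dots> = (- 1) ^ N * ((\<Prod>i=1..N. P - 2 * of_nat i)\<^sup>2 / (4 ^ N * fact N * (\<Prod>i=1..N. P - of_nat i)))"
    unfolding prod.distrib prod_dividef prod_power_distrib[symmetric] by (simp add: fact_prod)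
  also have "\<dots> = (- 1) ^ N * (fact (2 * N) / (fact N * fact N) / (4 ^ N * (2 ^ N) ^ 2))"
    unfolding 1 2 by (simp add: power2_eq_square mult_ac)
  also have "(4 :: rat) ^ N * (2 ^ N) ^ 2 = 16 ^ N" by (rule power_4_mult_power_2)
  finally show ?thesis by (simp add: binomial_fact mult.assoc[symmetric] power_mult_distrib[symmetric])
qed

section \<open>Congruences between p-integral rationals\<close>

lemma p_integral_iff:
  assumes "prime p"
  shows "p_integral p x \<longleftrightarrow> (\<exists>a b :: int. \<not> int p dvd b \<and> x = of_int a / of_int b)"
proof
  assume *: "p_integral p x"
  obtain a b where q: "quotient_of x = (a, b)" by (cases "quotient_of x")
  have "coprime b (int p)" using * q by (simp add: p_integral_def)
  hence "\<not> int p dvd b" using assms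
    by (metis coprime_common_divisor dvd_refl not_prime_unit prime_nat_int_transfer)
  thus "\<exists>a b :: int. \<not> int p dvd b \<and> x = of_int a / of_int b"
    using quotient_of_div[OF q] by blast
next
  assume "\<exists>a b :: int. \<not> int p dvd b \<and> x = of_int a / of_int b"
  then obtain a b where ab: "\<not> int p dvd b" "x = of_int a / of_int b" by blast
  obtain c d where q: "quotient_of x = (c, d)" by (cases "quotient_of x")
  have d: "d > 0" "coprime c d" "x = of_int c / of_int d"
    using quotient_of_denom_pos[OF q] quotient_of_coprime[OF q] quotient_of_div[OF q] by auto
  have "b \<noteq> 0" using ab(1) by auto
  hence "(of_int (c * b) :: rat) = of_int (a * d)" using d ab by (simp add: field_simps)
  hence "c * b = a * d" by (simp only: of_int_eq_iff)
  hence "d dvd c * b" by simp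
  hence "d dvd b" using d(2) by (simp add: coprime_commute coprime_dvd_mult_right_iff)
  hence "\<not> int p dvd d" using ab(1) dvd_trans by blast
  hence "coprime (int p) d" using assms by (intro prime_imp_coprime) auto
  thus "p_integral p x" using q by (simp add: p_integral_def coprime_commute)
qed

section \<open>The ring of \<open>p\<close>-integral rationals and its units\<close>

locale prime_gt_3 =
  fixes p :: nat
  assumes prime_p: "prime p" and p_gt_3: "p > 3"
begin

definition p_unit :: "rat \<Rightarrow> bool" where
  "p_unit x \<longleftrightarrow> x \<noteq> 0 \<and> p_integral p x \<and> p_integral p (1 / x)"

text \<open>Only the difference is constrained, in contrast to \<open>rat_cong\<close>; integrality
  of the left side is recovered from that of the right by \<open>pcong_integral\<close>.\<close>

definition pcong :: "nat \<Rightarrow> rat \<Rightarrow> rat \<Rightarrow> bool" where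
  "pcong m a b \<longleftrightarrow> p_integral p ((a - b) / of_nat p ^ m)"

definition half :: nat where
  "half = (p - 1) div 2"

lemma p_eq: "p = 2 * half + 1"
proof -
  have "odd p" using prime_odd_nat[OF prime_p] p_gt_3 by simp
  thus ?thesis unfolding half_def by presburger
qed

lemma p_integral_of_int [simp, intro]: "p_integral p (of_int k)"
  unfolding p_integral_iff[OF prime_p] using prime_p prime_gt_1_nat[OF prime_p]
  by (intro exI[of _ k] exI[of _ 1]) auto

lemma p_integral_of_nat [simp, intro]: "p_integral p (of_nat k)"
  using p_integral_of_int[of "int k"] by simp

lemma p_integral_numeral [simp, intro]: "p_integral p (numeral k)"
  using p_integral_of_nat[of "numeral k"] by simp

lemma p_integral_0 [simp, intro]: "p_integral p 0"
  using p_integral_of_nat[of 0] by simp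

lemma p_integral_1 [simp, intro]: "p_integral p 1"
  using p_integral_of_nat[of 1] by simp

lemma prime_int_p: "prime (int p)"
  using prime_p by simp

lemma p_integral_mult [intro]: "p_integral p (x * y)" if "p_integral p x" "p_integral p y"
proof -
  from that obtain a b c d where "\<not> int p dvd b" "x = of_int a / of_int b" "\<not> int p dvd d" "y = of_int c / of_int d"
    unfolding p_integral_iff[OF prime_p] by blast
  thus ?thesis unfolding p_integral_iff[OF prime_p]
    by (intro exI[of _ "a * c"] exI[of _ "b * d"]) (simp add: prime_dvd_mult_iff[OF prime_int_p])
qed

lemma p_integral_add [intro]: "p_integral p (x + y)" if "p_integral p x" "p_integral p y"
proof -
  from that obtain a b c d where *: "\<not> int p dvd b" "x = of_int a / of_int b" "\<not> int p dvd d" "y = of_int c / of_int d"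
    unfolding p_integral_iff[OF prime_p] by blast
  moreover from * have "b \<noteq> 0" "d \<noteq> 0" by auto
  ultimately show ?thesis unfolding p_integral_iff[OF prime_p]
    by (intro exI[of _ "a * d + b * c"] exI[of _ "b * d"])
       (simp add: prime_dvd_mult_iff[OF prime_int_p] field_simps)
qed

lemma p_integral_minus [intro]: "p_integral p (- x)" if "p_integral p x"
  using p_integral_mult[OF p_integral_of_int[of "-1"] that] by simp

lemma p_integral_diff [intro]: "p_integral p (x - y)" if "p_integral p x" "p_integral p y"
  using p_integral_add[OF that(1) p_integral_minus[OF that(2)]] by simp

lemma p_integral_power [intro]: "p_integral p x \<Longrightarrow> p_integral p (x ^ n)"
  by (induction n) auto

lemma p_integral_sum [intro]: "(\<And>i. i \<in> A \<Longrightarrow> p_integral p (f i)) \<Longrightarrow> p_integral p (sum f A)"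
  by (induction A rule: infinite_finite_induct) auto

lemma p_unit_nonzero: "p_unit x \<Longrightarrow> x \<noteq> 0"
  by (simp add: p_unit_def)

lemma p_unit_integral: "p_unit x \<Longrightarrow> p_integral p x"
  by (simp add: p_unit_def)

lemma p_integral_divide [intro]: "p_integral p x \<Longrightarrow> p_unit y \<Longrightarrow> p_integral p (x / y)"
  using p_integral_mult[of x "1 / y"] by (simp add: p_unit_def)

lemma p_unit_mult [intro]: "p_unit x \<Longrightarrow> p_unit y \<Longrightarrow> p_unit (x * y)"
  using p_integral_mult[of "1 / x" "1 / y"] by (auto simp: p_unit_def)

lemma p_unit_divide [intro]: "p_unit x \<Longrightarrow> p_unit y \<Longrightarrow> p_unit (x / y)"
  using p_integral_divide[of y x] p_integral_divide[of x y] by (simp add: p_unit_def)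

lemma p_unit_1 [simp, intro]: "p_unit 1"
  by (simp add: p_unit_def)

lemma p_unit_power [intro]: "p_unit x \<Longrightarrow> p_unit (x ^ n)"
  by (induction n) auto

lemma p_unit_minus [intro]: "p_unit x \<Longrightarrow> p_unit (- x)"
  using p_integral_minus[of "1 / x"] by (auto simp: p_unit_def)

lemma p_unit_of_int: "\<not> int p dvd k \<Longrightarrow> p_unit (of_int k)"
  unfolding p_unit_def p_integral_iff[OF prime_p, of "1 / _"]
  by (intro conjI exI[of _ 1] exI[of _ k]) auto

lemma p_unit_of_nat: "0 < k \<Longrightarrow> k < p \<Longrightarrow> p_unit (of_nat k)"
  using p_unit_of_int[of "int k"] by (simp add: nat_dvd_not_less)

declare p_unit_nonzero [simp] p_unit_integral [intro]

lemma p_unit_numeral_2_3: "p_unit 2" "p_unit 3"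
  using p_unit_of_nat[of 2] p_unit_of_nat[of 3] p_gt_3 by simp_all

text \<open>The constants in the denominators below have only the prime factors 2 and 3, so they are
  units for \<open>p > 3\<close>.\<close>

lemma p_unit_smooth: "p_unit (2 ^ a * 3 ^ b)"
  by (intro p_unit_mult p_unit_power p_unit_numeral_2_3)

lemma p_unit_numerals [simp, intro]:
  "p_unit 2" "p_unit 3" "p_unit 4" "p_unit 6" "p_unit 8" "p_unit 16" "p_unit 24" "p_unit 32"
  "p_unit 48" "p_unit 256"
  using p_unit_smooth[of 1 0] p_unit_smooth[of 0 1] p_unit_smooth[of 2 0] p_unit_smooth[of 1 1]
    p_unit_smooth[of 3 0] p_unit_smooth[of 4 0] p_unit_smooth[of 3 1] p_unit_smooth[of 5 0]
    p_unit_smooth[of 4 1] p_unit_smooth[of 8 0] by simp_all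

text \<open>Factoring out \<open>x\<close> leaves \<open>1 + p (y / x)\<close>; with
  \<open>y / x = c / d\<close> this is \<open>(d + p c) / d\<close>, whose numerator is prime to
  \<open>p\<close>.\<close>

lemma p_unit_add_p_mult: "p_unit (x + of_nat p * y)" if x: "p_unit x" and y: "p_integral p y"
proof -
  from that obtain a b c d where *: "\<not> int p dvd b" "1 / x = of_int a / of_int b" "\<not> int p dvd d" "y / x = of_int c / of_int d"
    using p_integral_divide[OF y x]  unfolding p_unit_def p_integral_iff[OF prime_p] by blast
  have "\<not> int p dvd d + int p * c" using *(3) by (simp add: dvd_add_left_iff)
  hence u: "p_unit (of_int (d + int p * c) / of_int d)"
    by (intro p_unit_divide p_unit_of_int *(3))
  have "d \<noteq> 0" using * by auto
  have "x + of_nat p * y = x * (1 + of_nat p * (y / x))" using x by (simp add: field_simps)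
  also have "1 + of_nat p * (y / x) = of_int (d + int p * c) / of_int d"
    unfolding *(4) using \<open>d \<noteq> 0\<close> by (simp add: field_simps)
  finally show ?thesis using p_unit_mult[OF x u] by simp
qed

lemma p_nonzero: "(of_nat p :: rat) \<noteq> 0"
  using p_gt_3 by simp

section \<open>Congruences modulo powers of \<open>p\<close>\<close>

lemma pcong_iff: "pcong m a b \<longleftrightarrow> (\<exists>z. p_integral p z \<and> a = b + of_nat p ^ m * z)"
proof
  assume "pcong m a b"
  thus "\<exists>z. p_integral p z \<and> a = b + of_nat p ^ m * z"
    unfolding pcong_def using p_nonzero by (intro exI[of _ "(a - b) / of_nat p ^ m"]) simp
next
  assume "\<exists>z. p_integral p z \<and> a = b + of_nat p ^ m * z"
  thus "pcong m a b" unfolding pcong_def using p_nonzero by auto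
qed

lemma pcongI: "p_integral p z \<Longrightarrow> a - b = of_nat p ^ m * z \<Longrightarrow> pcong m a b"
  unfolding pcong_iff by (intro exI[of _ z]) (auto simp: algebra_simps)

lemma pcong_refl [simp, intro]: "pcong m a a"
  by (simp add: pcong_def)

lemma pcong_sym: "pcong m a b \<Longrightarrow> pcong m b a"
  unfolding pcong_def using p_integral_minus[of "(a - b) / of_nat p ^ m"] by (simp add: minus_divide_left)

lemma pcong_trans [trans]: "pcong m a b \<Longrightarrow> pcong m b c \<Longrightarrow> pcong m a c"
  unfolding pcong_def using p_integral_add[of "(a - b) / of_nat p ^ m" "(b - c) / of_nat p ^ m"]
  by (simp add: add_divide_distrib[symmetric])

lemma pcong_add: "pcong m a b \<Longrightarrow> pcong m c d \<Longrightarrow> pcong m (a + c) (b + d)"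
  unfolding pcong_def using p_integral_add[of "(a - b) / of_nat p ^ m" "(c - d) / of_nat p ^ m"]
  by (simp add: add_divide_distrib[symmetric] algebra_simps)

lemma pcong_minus: "pcong m a b \<Longrightarrow> pcong m (- a) (- b)"
  unfolding pcong_def using p_integral_minus[of "(a - b) / of_nat p ^ m"] by (simp add: minus_divide_left)

lemma pcong_diff: "pcong m a b \<Longrightarrow> pcong m c d \<Longrightarrow> pcong m (a - c) (b - d)"
  using pcong_add[of m a b "- c" "- d"] pcong_minus[of m c d] by simp

lemma pcong_cmult: "pcong m a b \<Longrightarrow> p_integral p c \<Longrightarrow> pcong m (c * a) (c * b)"
  unfolding pcong_def using p_integral_mult[of c "(a - b) / of_nat p ^ m"] by (simp add: right_diff_distrib)

lemma pcong_mult: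
  assumes "pcong m a b" "pcong m c d" "p_integral p c" "p_integral p b"
  shows "pcong m (a * c) (b * d)"
proof -
  have "pcong m (c * a) (c * b)" by (rule pcong_cmult) fact+
  moreover have "pcong m (b * c) (b * d)" by (rule pcong_cmult) fact+
  ultimately show ?thesis unfolding mult.commute[of c] by (rule pcong_trans)
qed

lemma pcong_integral: "pcong m a b \<Longrightarrow> p_integral p b \<Longrightarrow> p_integral p a"
  unfolding pcong_iff by auto

lemma pcong_sum: "(\<And>i. i \<in> A \<Longrightarrow> pcong m (f i) (g i)) \<Longrightarrow> pcong m (sum f A) (sum g A)"
  by (induction A rule: infinite_finite_induct) (auto intro: pcong_add)

lemma pcong_scale: "pcong m a b \<Longrightarrow> pcong (r + m) (of_nat p ^ r * a) (of_nat p ^ r * b)"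
  unfolding pcong_def power_add right_diff_distrib[symmetric] using p_nonzero by simp

lemma pcong_inverse:
  assumes "pcong m a b" "p_unit a" "p_unit b"
  shows "pcong m (1 / a) (1 / b)"
proof -
  have "pcong m (1 / (a * b) * b) (1 / (a * b) * a)"
    using assms by (intro pcong_cmult pcong_sym[OF assms(1)]) auto
  thus ?thesis using assms by simp
qed

text \<open>Every further term of the expansion contains \<open>p^r\<close> at least twice. It is
  applied with \<open>r = 2\<close> for precision \<open>p^4\<close> and with \<open>r = 1\<close>
  for precision \<open>p^2\<close>.\<close>

lemma pcong_prod_one_plus:
  assumes "\<And>i. i \<in> A \<Longrightarrow> p_integral p (y i)"
  shows "pcong (2 * r) (\<Prod>i\<in>A. 1 + of_nat p ^ r * y i) (1 + of_nat p ^ r * (\<Sum>i\<in>A. y i))"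
  using assms
proof (induction A rule: infinite_finite_induct)
  case (insert a A)
  let ?q = "of_nat p ^ r :: rat"
  have "(\<Prod>i\<in>insert a A. 1 + ?q * y i) = (1 + ?q * y a) * (\<Prod>i\<in>A. 1 + ?q * y i)"
    using insert by simp
  also have "pcong (2 * r) \<dots> ((1 + ?q * y a) * (1 + ?q * (\<Sum>i\<in>A. y i)))"
    using insert by (intro pcong_cmult insert.IH) auto
  also have "pcong (2 * r) \<dots> (1 + ?q * (\<Sum>i\<in>insert a A. y i))"
    by (rule pcongI[of "y a * (\<Sum>i\<in>A. y i)"])
       (use insert in \<open>auto simp: algebra_simps mult_2_right power_add\<close>)
  finally show ?case .
qed auto

end

section \<open>Harmonic sums\<close>

definition gharm :: "nat \<Rightarrow> nat \<Rightarrow> rat" where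
  "gharm r n = (\<Sum>i=1..n. 1 / of_nat i ^ r)"

lemma gharm_0 [simp]: "gharm r 0 = 0"
  by (simp add: gharm_def)

lemma gharm_Suc: "gharm r (Suc n) = gharm r n + 1 / of_nat (Suc n) ^ r"
  by (simp add: gharm_def)

lemma sum_odd_reciprocals: "(\<Sum>i<m. 1 / (2 * of_nat i + 1)) = gharm 1 (2 * m) - gharm 1 m / 2"
proof (induction m)
  case (Suc m)
  have "2 * Suc m = Suc (Suc (2 * m))" by simp
  hence "gharm 1 (2 * Suc m) = gharm 1 (2 * m) + 1 / (2 * of_nat m + 1) + 1 / (2 * of_nat (Suc m))"
    by (simp only: gharm_Suc) (simp add: add_ac)
  moreover have "gharm 1 (Suc m) / 2 = gharm 1 m / 2 + 1 / (2 * of_nat (Suc m))"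
    by (simp add: gharm_Suc add_divide_distrib)
  ultimately show ?case using Suc.IH unfolding sum.lessThan_Suc by linarith
qed simp

lemma sum_alternating_reciprocals: "(\<Sum>i=1..2 * m. (- 1) ^ i / of_nat i) = gharm 1 m - gharm 1 (2 * m)"
proof (induction m)
  case (Suc m)
  have e: "2 * Suc m = Suc (Suc (2 * m))" by simp
  have "gharm 1 (2 * Suc m) = gharm 1 (2 * m) + 1 / of_nat (Suc (2 * m)) + 1 / of_nat (Suc (Suc (2 * m)))"
    unfolding e by (simp only: gharm_Suc power_one_right)
  moreover have "(\<Sum>i=1..2 * Suc m. (- 1) ^ i / of_nat i) = (\<Sum>i=1..2 * m. (- 1) ^ i / of_nat i)
      - 1 / of_nat (Suc (2 * m)) + (1 / of_nat (Suc (Suc (2 * m))) :: rat)"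
    unfolding e by simp
  moreover have "gharm 1 (Suc m) = gharm 1 m + 2 / of_nat (Suc (Suc (2 * m)))"
  proof -
    have "(of_nat (Suc (Suc (2 * m))) :: rat) = 2 * of_nat (Suc m)" by simp
    thus ?thesis unfolding gharm_Suc by (simp del: of_nat_Suc)
  qed
  ultimately show ?case using Suc.IH by simp
qed simp

context prime_gt_3
begin

lemma p_unit_index: "i \<in> {1..half} \<Longrightarrow> p_unit (of_nat i)"
  using p_eq by (intro p_unit_of_nat) auto

lemma p_unit_below: "i \<in> {1..p - 1} \<Longrightarrow> p_unit (of_nat i)"
  using p_gt_3 by (intro p_unit_of_nat) auto

lemma p_unit_sub_p: "p_unit x \<Longrightarrow> p_unit (x - of_nat p)"
  using p_unit_add_p_mult[of x "-1"] by auto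

lemma p_unit_p_sub: "p_unit x \<Longrightarrow> p_unit (of_nat p - x)"
  using p_unit_minus[OF p_unit_sub_p[of x]] by simp

lemma gharm_integral: "n < p \<Longrightarrow> p_integral p (gharm r n)"
  unfolding gharm_def by (intro p_integral_sum p_integral_divide p_unit_power p_unit_of_nat) auto

lemma gharm_half_integral: "p_integral p (gharm r half)"
  using p_eq by (intro gharm_integral) simp

text \<open>First-order expansion of \<open>central_binomial_prod\<close>. The coefficient
  \<open>p^2\<close> in front means that each \<open>y i\<close> matters only modulo
  \<open>p^2\<close>.\<close>

lemma central_binomial_cong:
  "pcong 4 (of_nat ((2 * half) choose half) / 16 ^ half)
     ((- 1) ^ half * (1 + of_nat p ^ 2 * ((gharm 2 half + of_nat p * gharm 3 half) / 4)))"
proof -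
  define y where "y = (\<lambda>i. 1 / (4 * of_nat i * (of_nat i - of_nat p)) :: rat)"
  have y: "p_integral p (y i)" "pcong 2 (y i) ((1 / of_nat i ^ 2 + of_nat p * (1 / of_nat i ^ 3)) / 4)"
    if "i \<in> {1..half}" for i
  proof -
    define x :: rat where "x = of_nat i"
    have u: "p_unit x" "p_unit (x - of_nat p)"
      using p_unit_index[OF that] p_unit_sub_p unfolding x_def by auto
    show "p_integral p (y i)" unfolding y_def x_def[symmetric] using u
      by (intro p_integral_divide p_unit_mult) auto
    \<comment> \<open>From \<open>1/(x - p) = 1/x + p/x^2 + p^2/(x^2 (x - p))\<close>, divided by
      \<open>4 x\<close>; the last term supplies the witness.\<close>
    show "pcong 2 (y i) ((1 / of_nat i ^ 2 + of_nat p * (1 / of_nat i ^ 3)) / 4)"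
    proof (rule pcongI[of "1 / (4 * x ^ 3 * (x - of_nat p))"])
      show "p_integral p (1 / (4 * x ^ 3 * (x - of_nat p)))" using u
        by (intro p_integral_divide p_unit_mult) auto
      show "y i - (1 / of_nat i ^ 2 + of_nat p * (1 / of_nat i ^ 3)) / 4 =
        of_nat p ^ 2 * (1 / (4 * x ^ 3 * (x - of_nat p)))"
        using u[THEN p_unit_nonzero] unfolding y_def x_def[symmetric]
        by (simp add: divide_simps) (simp add: eval_nat_numeral algebra_simps)
    qed
  qed
  have "pcong (2 * 2) (\<Prod>i=1..half. 1 + of_nat p ^ 2 * y i) (1 + of_nat p ^ 2 * (\<Sum>i=1..half. y i))"
    by (rule pcong_prod_one_plus) (rule y)
  hence 1: "pcong 4 (\<Prod>i=1..half. 1 + of_nat p ^ 2 * y i) (1 + of_nat p ^ 2 * (\<Sum>i=1..half. y i))" by simp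
  have "pcong (2 + 2) (1 + of_nat p ^ 2 * (\<Sum>i=1..half. y i))
      (1 + of_nat p ^ 2 * ((gharm 2 half + of_nat p * gharm 3 half) / 4))"
  proof (intro pcong_add pcong_scale pcong_refl)
    have "pcong 2 (\<Sum>i=1..half. y i) (\<Sum>i=1..half. (1 / of_nat i ^ 2 + of_nat p * (1 / of_nat i ^ 3)) / 4)"
      by (rule pcong_sum) (rule y)
    thus "pcong 2 (\<Sum>i=1..half. y i) ((gharm 2 half + of_nat p * gharm 3 half) / 4)"
      by (simp only: gharm_def sum_divide_distrib[symmetric] sum.distrib sum_distrib_left)
  qed
  hence "pcong 4 (1 + of_nat p ^ 2 * (\<Sum>i=1..half. y i))
      (1 + of_nat p ^ 2 * ((gharm 2 half + of_nat p * gharm 3 half) / 4))" by simp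
  with 1 have "pcong 4 (\<Prod>i=1..half. 1 + of_nat p ^ 2 * y i)
      (1 + of_nat p ^ 2 * ((gharm 2 half + of_nat p * gharm 3 half) / 4))"
    by (rule pcong_trans)
  hence "pcong 4 ((- 1) ^ half * (\<Prod>i=1..half. 1 + of_nat p ^ 2 * y i))
     ((- 1) ^ half * (1 + of_nat p ^ 2 * ((gharm 2 half + of_nat p * gharm 3 half) / 4)))"
    by (rule pcong_cmult) auto
  thus ?thesis using central_binomial_prod[of half] unfolding y_def p_eq[symmetric] by simp
qed

lemma sine_prod_cong:
  "pcong 4 (sine_prod half (of_nat p ^ 2)) (1 + of_nat p ^ 2 * (- gharm 2 half / 16))"
proof -
  have "pcong (2 * 2) (\<Prod>i=1..half. 1 + of_nat p ^ 2 * (- (1 / (16 * of_nat i ^ 2))))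
     (1 + of_nat p ^ 2 * (\<Sum>i=1..half. - (1 / (16 * of_nat i ^ 2))))"
    by (rule pcong_prod_one_plus)
       (intro p_integral_minus p_integral_divide p_unit_mult p_unit_power p_unit_index, auto)
  thus ?thesis by (simp add: sine_prod_def gharm_def sum_negf sum_divide_distrib mult.commute)
qed

section \<open>Harmonic sums under the reflection \<open>i \<mapsto> p - i\<close>\<close>

lemma sum_p_reflect:
  fixes f :: "nat \<Rightarrow> rat"
  shows "(\<Sum>k=1..p - 1. f k) = (\<Sum>i=1..half. f i + f (p - i))"
proof -
  have "{1..p - 1} = {1..half} \<union> {half + 1..p - 1}" using p_eq by auto
  hence "(\<Sum>k=1..p - 1. f k) = (\<Sum>k=1..half. f k) + (\<Sum>k=half + 1..p - 1. f k)"
    by (simp only:) (rule sum.union_disjoint, auto)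
  also have "(\<Sum>k=half + 1..p - 1. f k) = (\<Sum>i=1..half. f (p - i))"
    by (rule sum.reindex_bij_witness[of _ "\<lambda>i. p - i" "\<lambda>i. p - i"]) (use p_eq in auto)
  finally show ?thesis by (simp add: sum.distrib)
qed

lemma sum_p_even_odd:
  fixes f :: "nat \<Rightarrow> rat"
  shows "(\<Sum>k=1..p - 1. f k) = (\<Sum>i=1..half. f (2 * i) + f (p - 2 * i))"
proof -
  have "(\<Sum>k=1..2 * n. f k) = (\<Sum>i=1..n. f (2 * i)) + (\<Sum>i<n. f (2 * i + 1))" for n
    by (induction n) simp_all
  hence "(\<Sum>k=1..p - 1. f k) = (\<Sum>i=1..half. f (2 * i)) + (\<Sum>i<half. f (2 * i + 1))"
    using p_eq by (metis add_diff_cancel_right')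
  also have "(\<Sum>i<half. f (2 * i + 1)) = (\<Sum>i=1..half. f (p - 2 * i))"
    by (rule sum.reindex_bij_witness[of _ "\<lambda>i. half - i" "\<lambda>i. half - i"])
       (use p_eq in \<open>auto intro!: arg_cong[of _ _ f]\<close>)
  finally show ?thesis by (simp add: sum.distrib)
qed

lemma of_nat_p_diff: "i \<le> p \<Longrightarrow> (of_nat (p - i) :: rat) = of_nat p - of_nat i"
  by (simp add: of_nat_diff)

text \<open>The sum \<open>T\<close> of all inverse squares is computed twice. Pairing
  \<open>i\<close> with \<open>p - i\<close> gives \<open>2 H_2 + 2 p H_3\<close>, pairing
  \<open>2 i\<close> with \<open>p - 2 i\<close> gives \<open>H_2 / 2 + p H_3 / 4\<close>;
  comparison determines \<open>H_2\<close>.\<close>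

lemma gharm_2_half_cong: "pcong 2 (gharm 2 half) (- 7 / 6 * of_nat p * gharm 3 half)"
proof -
  let ?P = "of_nat p :: rat"
  \<comment> \<open>Expansion of \<open>1 / (p - x)^2\<close> to first order in \<open>p\<close>;
    the witness below is the exact remainder divided by \<open>p^2\<close>.\<close>
  have refl2: "pcong 2 (1 / (?P - x) ^ 2) (1 / x ^ 2 + 2 * ?P / x ^ 3)" if "p_unit x" for x
  proof (rule pcongI[of "(3 * x - 2 * ?P) / (x ^ 3 * (?P - x) ^ 2)"])
    show "p_integral p ((3 * x - 2 * ?P) / (x ^ 3 * (?P - x) ^ 2))" using that p_unit_p_sub[OF that]
      by (intro p_integral_divide p_unit_mult p_unit_power p_integral_diff p_integral_mult) auto
    show "1 / (?P - x) ^ 2 - (1 / x ^ 2 + 2 * ?P / x ^ 3) = ?P ^ 2 * ((3 * x - 2 * ?P) / (x ^ 3 * (?P - x) ^ 2))"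
      using that[THEN p_unit_nonzero] p_unit_p_sub[OF that, THEN p_unit_nonzero]
      by (simp add: divide_simps) (simp add: eval_nat_numeral algebra_simps)
  qed
  define T where "T = (\<Sum>k=1..p - 1. 1 / of_nat k ^ 2 :: rat)"
  have "T = (\<Sum>i=1..half. 1 / of_nat i ^ 2 + 1 / (?P - of_nat i) ^ 2)"
    unfolding T_def sum_p_reflect using p_eq by (intro sum.cong refl) (subst of_nat_p_diff, auto)
  also have "pcong 2 \<dots> (\<Sum>i=1..half. 1 / of_nat i ^ 2 + (1 / of_nat i ^ 2 + 2 * ?P / of_nat i ^ 3))"
    by (intro pcong_sum pcong_add pcong_refl refl2 p_unit_index)
  also have "\<dots> = 2 * gharm 2 half + 2 * ?P * gharm 3 half"
    by (simp add: gharm_def sum.distrib sum_distrib_left)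
  finally have 1: "pcong 2 T (2 * gharm 2 half + 2 * ?P * gharm 3 half)" .
  have T: "T = (\<Sum>i=1..half. 1 / (2 * of_nat i) ^ 2 + 1 / (?P - 2 * of_nat i) ^ 2)"
    unfolding T_def sum_p_even_odd using p_eq by (intro sum.cong refl) (subst of_nat_p_diff, auto)
  have "pcong 2 T (\<Sum>i=1..half. 1 / (2 * of_nat i) ^ 2 + (1 / (2 * of_nat i) ^ 2 + 2 * ?P / (2 * of_nat i) ^ 3))"
    unfolding T by (intro pcong_sum pcong_add pcong_refl refl2 p_unit_mult p_unit_index) auto
  moreover have "(\<Sum>i=1..half. 1 / (2 * of_nat i) ^ 2 + (1 / (2 * of_nat i) ^ 2 + 2 * ?P / (2 * of_nat i) ^ 3)) =
      (\<Sum>i=1..half. 1 / 2 * (1 / of_nat i ^ 2) + 1 / 4 * ?P * (1 / of_nat i ^ 3))"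
  proof (rule sum.cong)
    fix i
    have "1 / (2 * y) ^ 2 = 1 / 4 * (1 / y ^ 2)" "2 * r / (2 * y) ^ 3 = 1 / 4 * r * (1 / y ^ 3)" for y r :: rat
      by (simp_all add: power_mult_distrib)
    moreover have "1 / 4 * y + (1 / 4 * y + z) = 1 / 2 * y + z" for y z :: rat by simp
    ultimately show "1 / (2 * of_nat i) ^ 2 + (1 / (2 * of_nat i) ^ 2 + 2 * ?P / (2 * of_nat i) ^ 3) =
      1 / 2 * (1 / of_nat i ^ 2) + 1 / 4 * ?P * (1 / of_nat i ^ 3)" by (simp only:)
  qed simp
  moreover have "\<dots> = 1 / 2 * gharm 2 half + 1 / 4 * ?P * gharm 3 half"
    by (simp only: gharm_def sum.distrib sum_distrib_left)
  ultimately have 2: "pcong 2 T (1 / 2 * gharm 2 half + 1 / 4 * ?P * gharm 3 half)" by (simp only:)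
  have "pcong 2 (2 * gharm 2 half + 2 * ?P * gharm 3 half) (1 / 2 * gharm 2 half + 1 / 4 * ?P * gharm 3 half)"
    using pcong_trans[OF pcong_sym[OF 1] 2] .
  hence "pcong 2 ((2 * gharm 2 half + 2 * ?P * gharm 3 half) - (1 / 2 * gharm 2 half + 2 * ?P * gharm 3 half))
     ((1 / 2 * gharm 2 half + 1 / 4 * ?P * gharm 3 half) - (1 / 2 * gharm 2 half + 2 * ?P * gharm 3 half))"
    by (intro pcong_diff pcong_refl)
  \<comment> \<open>The factor \<open>2/3\<close> inverts the coefficient \<open>2 - 1/2\<close> of
    \<open>H_2\<close>; on the right it gives \<open>2/3 * (1/4 - 2) = -7/6\<close>.\<close>
  hence "pcong 2 (2 / 3 * ((2 * gharm 2 half + 2 * ?P * gharm 3 half) - (1 / 2 * gharm 2 half + 2 * ?P * gharm 3 half)))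
     (2 / 3 * ((1 / 2 * gharm 2 half + 1 / 4 * ?P * gharm 3 half) - (1 / 2 * gharm 2 half + 2 * ?P * gharm 3 half)))"
    by (rule pcong_cmult) auto
  thus ?thesis by (simp add: algebra_simps)
qed

text \<open>For \<open>n = 0\<close> the terms \<open>1/i\<close> and \<open>1/(p - i)\<close>
  cancel modulo \<open>p\<close>. Each further step removes \<open>1/(p - (n+1))\<close>, which is
  congruent to \<open>-1/(n+1)\<close>.\<close>

lemma gharm_1_reflect: "n < p \<Longrightarrow> pcong 1 (gharm 1 (p - 1 - n)) (gharm 1 n)"
proof (induction n)
  case 0
  have "gharm 1 (p - 1) = (\<Sum>i=1..half. 1 / of_nat i + 1 / (of_nat p - of_nat i))"
    unfolding gharm_def sum_p_reflect using p_eq by (intro sum.cong refl) (subst of_nat_p_diff, auto)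
  also have "pcong 1 \<dots> (\<Sum>i=1..half. 0)"
  proof (intro pcong_sum)
    fix i assume i: "i \<in> {1..half}"
    define x :: rat where "x = of_nat i"
    have u: "p_unit x" "p_unit (of_nat p - x)"
      using p_unit_index[OF i] p_unit_p_sub unfolding x_def by auto
    show "pcong 1 (1 / of_nat i + 1 / (of_nat p - of_nat i)) 0"
      unfolding x_def[symmetric]
    proof (rule pcongI[of "1 / (x * (of_nat p - x))"])
      show "p_integral p (1 / (x * (of_nat p - x)))" using u by (intro p_integral_divide p_unit_mult) auto
      show "1 / x + 1 / (of_nat p - x) - 0 = of_nat p ^ 1 * (1 / (x * (of_nat p - x)))"
        using u[THEN p_unit_nonzero] by (simp add: field_simps)
    qed
  qed
  finally show ?case by simp
next
  case (Suc n)
  define x :: rat where "x = of_nat (Suc n)"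
  have e: "p - 1 - n = Suc (p - 1 - Suc n)" "Suc (p - 1 - Suc n) = p - Suc n" using Suc.prems by auto
  have u: "p_unit x" "p_unit (of_nat p - x)"
    unfolding x_def using p_unit_of_nat[of "Suc n"] Suc.prems p_unit_p_sub by auto
  have "pcong 1 (1 / (of_nat p - x)) (- (1 / x))"
  proof (rule pcongI[of "1 / (x * (of_nat p - x))"])
    show "p_integral p (1 / (x * (of_nat p - x)))" using u by (intro p_integral_divide p_unit_mult) auto
    show "1 / (of_nat p - x) - - (1 / x) = of_nat p ^ 1 * (1 / (x * (of_nat p - x)))"
      using u[THEN p_unit_nonzero] by (simp add: field_simps)
  qed
  moreover have "gharm 1 (p - 1 - n) = gharm 1 (p - 1 - Suc n) + 1 / (of_nat p - x)"
    unfolding e(1) gharm_Suc unfolding e(2) x_def of_nat_p_diff[OF less_imp_le[OF Suc.prems]]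
    by (simp only: power_one_right)
  ultimately have "pcong 1 (gharm 1 (p - 1 - n) - 1 / (of_nat p - x)) (gharm 1 n - - (1 / x))"
    using Suc by (intro pcong_diff) auto
  thus ?case using \<open>gharm 1 (p - 1 - n) = _\<close> by (simp add: gharm_Suc x_def)
qed

lemma pcong_reflect: "p_unit x \<Longrightarrow> pcong 1 (1 / (of_nat p - x)) (- (1 / x))"
proof -
  assume x: "p_unit x"
  have "pcong 1 (of_nat p - x) (- x)" by (rule pcongI[of 1]) auto
  hence "pcong 1 (1 / (of_nat p - x)) (1 / (- x))"
    by (rule pcong_inverse) (use x in \<open>auto intro: p_unit_p_sub\<close>)
  thus ?thesis by simp
qed

section \<open>Signed double harmonic sums\<close>

lemma odd_p: "odd p"
  by (subst p_eq) simp

lemma minus_one_power_p_diff: "i \<le> p \<Longrightarrow> (- 1 :: rat) ^ (p - i) = - ((- 1) ^ i)"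
  using odd_p by (auto simp: uminus_power_if)

text \<open>The reflection \<open>i \<mapsto> p - n\<close>, \<open>n \<mapsto> p - i\<close> of the triangle \<open>i < n\<close> exchanges the two sign patterns.\<close>

lemma triangle_sum_reflect:
  "pcong 1 (\<Sum>n=1..p - 1. \<Sum>i\<in>{1..<n}. (- 1) ^ i / (of_nat i * of_nat (n - i) * of_nat n))
     (- (\<Sum>n=1..p - 1. \<Sum>i\<in>{1..<n}. (- 1) ^ n / (of_nat i * of_nat (n - i) * of_nat n)))"
proof -
  let ?T = "SIGMA n:{1..p - 1}. {1..<n}"
  have "(\<Sum>n=1..p - 1. \<Sum>i\<in>{1..<n}. (- 1) ^ i / (of_nat i * of_nat (n - i) * of_nat n)) =
      (\<Sum>(n, i)\<in>?T. (- 1) ^ i / (of_nat i * of_nat (n - i) * of_nat n) :: rat)"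
    by (rule sum.Sigma) auto
  also have "\<dots> = (\<Sum>(n, i)\<in>?T. (- 1) ^ (p - n) / (of_nat (p - n) * of_nat (n - i) * of_nat (p - i)))"
    by (rule sum.reindex_bij_witness[of _ "\<lambda>(n, i). (p - i, p - n)" "\<lambda>(n, i). (p - i, p - n)"]) auto
  also have "pcong 1 \<dots> (\<Sum>(n, i)\<in>?T. - ((- 1) ^ n / (of_nat i * of_nat (n - i) * of_nat n)))"
  proof (rule pcong_sum, clarify)
    fix n i assume ni: "n \<in> {1..p - 1}" "i \<in> {1..<n}"
    hence u: "p_unit (of_nat n)" "p_unit (of_nat i)" "p_unit (of_nat (n - i))"
      by (auto intro!: p_unit_below simp del: of_nat_diff)
    have le: "n \<le> p" "i \<le> p" using ni by auto
    \<comment> \<open>The signs of the two reflected reciprocals cancel and \<open>n - i\<close> is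
      invariant; the overall minus sign comes from \<open>(- 1) ^ (p - n)\<close>, as
      \<open>p\<close> is odd.\<close>
    have "pcong 1 (1 / (of_nat p - of_nat n) * (1 / (of_nat p - of_nat i))) (- (1 / of_nat n) * - (1 / of_nat i))"
      using u by (intro pcong_mult pcong_reflect) (auto intro: p_unit_p_sub)
    hence "pcong 1 (- ((- 1) ^ n) / of_nat (n - i) * (1 / (of_nat p - of_nat n) * (1 / (of_nat p - of_nat i))))
        (- ((- 1) ^ n) / of_nat (n - i) * (- (1 / of_nat n) * - (1 / of_nat i)))"
      using u by (intro pcong_cmult p_integral_divide p_integral_minus p_integral_power) auto
    thus "pcong 1 ((- 1) ^ (p - n) / (of_nat (p - n) * of_nat (n - i) * of_nat (p - i)))
        (- ((- 1) ^ n / (of_nat i * of_nat (n - i) * of_nat n)))"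
      unfolding minus_one_power_p_diff[OF le(1)] of_nat_p_diff[OF le(1)] of_nat_p_diff[OF le(2)]
      by (simp add: mult_ac del: of_nat_diff)
  qed
  also have "\<dots> = - (\<Sum>(n, i)\<in>?T. (- 1) ^ n / (of_nat i * of_nat (n - i) * of_nat n))"
    by (simp add: sum_negf case_prod_unfold)
  also have "(\<Sum>(n, i)\<in>?T. (- 1) ^ n / (of_nat i * of_nat (n - i) * of_nat n)) =
      (\<Sum>n=1..p - 1. \<Sum>i\<in>{1..<n}. (- 1) ^ n / (of_nat i * of_nat (n - i) * of_nat n) :: rat)"
    by (rule sum.Sigma[symmetric]) auto
  finally show ?thesis .
qed

text \<open>Uses \<open>1/(i (n - i)) = (1/i + 1/(n - i)) / n\<close> and then reverses
  \<open>i\<close> in the second half. Triangle sums thereby become sums over \<open>n\<close> with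
  harmonic inner sums.\<close>

lemma partial_fraction_sum:
  fixes g :: "nat \<Rightarrow> rat"
  shows "(\<Sum>i\<in>{1..<n}. g i / (of_nat i * of_nat (n - i) * of_nat n)) =
    (\<Sum>i\<in>{1..<n}. (g i + g (n - i)) / of_nat i) / of_nat n ^ 2"
proof -
  have "(\<Sum>i\<in>{1..<n}. g i / (of_nat i * of_nat (n - i) * of_nat n)) =
    (\<Sum>i\<in>{1..<n}. (g i / of_nat i + g i / of_nat (n - i)) / of_nat n ^ 2)"
  proof (rule sum.cong)
    fix i assume i: "i \<in> {1..<n}"
    have "g i / (x * y * z) = (g i / x + g i / y) / z ^ 2" if "x \<noteq> 0" "y \<noteq> 0" "z = x + y" "z \<noteq> 0" for x y z :: rat
    proof -
      have "g i / x + g i / y = g i * z / (x * y)" using that by (simp add: field_simps)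
      thus ?thesis using that(4) by (simp add: power2_eq_square)
    qed
    moreover have "of_nat i \<noteq> (0 :: rat)" "of_nat (n - i) \<noteq> (0 :: rat)" "of_nat n \<noteq> (0 :: rat)"
      using i unfolding of_nat_eq_0_iff by auto
    moreover have "of_nat n = (of_nat i + of_nat (n - i) :: rat)"
      using i unfolding of_nat_add[symmetric] by simp
    ultimately show "g i / (of_nat i * of_nat (n - i) * of_nat n) = (g i / of_nat i + g i / of_nat (n - i)) / of_nat n ^ 2"
      by blast
  qed simp
  also have "\<dots> = ((\<Sum>i\<in>{1..<n}. g i / of_nat i) + (\<Sum>i\<in>{1..<n}. g i / of_nat (n - i))) / of_nat n ^ 2"
    by (simp only: sum_divide_distrib[symmetric] sum.distrib)
  also have "(\<Sum>i\<in>{1..<n}. g i / of_nat (n - i)) = (\<Sum>i\<in>{1..<n}. g (n - i) / of_nat i)"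
    by (rule sum.reindex_bij_witness[of _ "\<lambda>i. n - i" "\<lambda>i. n - i"]) auto
  finally show ?thesis by (simp add: sum.distrib add_divide_distrib)
qed

text \<open>Modulo \<open>p\<close>, the reflection \<open>n \<mapsto> p - n\<close> turns
  \<open>H_(n-1)\<close> into \<open>H_n\<close> and reverses the sign. Adding the sum to its
  reflection leaves \<open>H_(n-1) - H_n = -1/n\<close>, hence an alternating sum of inverse
  cubes.\<close>

lemma alternating_gharm_sum_cong:
  "pcong 1 (2 * (\<Sum>n=1..p - 1. (- 1) ^ n * gharm 1 (n - 1) / of_nat n ^ 2)) (- gharm 3 half / 4)"
proof -
  define R where "R = (\<Sum>n=1..p - 1. (- 1) ^ n * gharm 1 (n - 1) / of_nat n ^ 2)"
  have "R = (\<Sum>n=1..p - 1. (- 1) ^ (p - n) * gharm 1 (p - n - 1) / of_nat (p - n) ^ 2)"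
    unfolding R_def by (rule sum.reindex_bij_witness[of _ "\<lambda>i. p - i" "\<lambda>i. p - i"]) auto
  also have "pcong 1 \<dots> (\<Sum>n=1..p - 1. - ((- 1) ^ n * gharm 1 n / of_nat n ^ 2))"
  proof (rule pcong_sum)
    fix n assume n: "n \<in> {1..p - 1}"
    hence le: "n \<le> p" "n < p" and e: "p - n - 1 = p - 1 - n" by auto
    note u = p_unit_below[OF n]
    have "pcong 1 (gharm 1 (p - 1 - n) * (1 / (of_nat p - of_nat n) * (1 / (of_nat p - of_nat n))))
        (gharm 1 n * (- (1 / of_nat n) * - (1 / of_nat n)))"
      using u le p_unit_p_sub[OF u]
      by (intro pcong_mult pcong_reflect gharm_1_reflect gharm_integral p_integral_mult p_integral_divide) auto
    hence "pcong 1 (- ((- 1) ^ n) * (gharm 1 (p - 1 - n) * (1 / (of_nat p - of_nat n) * (1 / (of_nat p - of_nat n)))))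
        (- ((- 1) ^ n) * (gharm 1 n * (- (1 / of_nat n) * - (1 / of_nat n))))"
      by (rule pcong_cmult) auto
    thus "pcong 1 ((- 1) ^ (p - n) * gharm 1 (p - n - 1) / of_nat (p - n) ^ 2)
       (- ((- 1) ^ n * gharm 1 n / of_nat n ^ 2))"
      unfolding minus_one_power_p_diff[OF le(1)] of_nat_p_diff[OF le(1)] e
      by (simp add: power2_eq_square)
  qed
  finally have "pcong 1 (R + R) (R + (\<Sum>n=1..p - 1. - ((- 1) ^ n * gharm 1 n / of_nat n ^ 2)))"
    by (intro pcong_add pcong_refl)
  also have "R + (\<Sum>n=1..p - 1. - ((- 1) ^ n * gharm 1 n / of_nat n ^ 2)) = (\<Sum>n=1..p - 1. - ((- 1) ^ n * (1 / of_nat n) ^ 3))"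
    unfolding R_def sum.distrib[symmetric]
  proof (rule sum.cong)
    fix n assume "n \<in> {1..p - 1}"
    hence "n = Suc (n - 1)" by simp
    hence g: "gharm 1 n = gharm 1 (n - 1) + 1 / of_nat n" using gharm_Suc[of 1 "n - 1"] by simp
    show "(- 1) ^ n * gharm 1 (n - 1) / of_nat n ^ 2 + - ((- 1) ^ n * gharm 1 n / of_nat n ^ 2) = - ((- 1) ^ n * (1 / of_nat n) ^ 3)"
      unfolding g by (simp add: algebra_simps add_divide_distrib power2_eq_square power3_eq_cube)
  qed simp
  also have "\<dots> = (\<Sum>i=1..half. - ((1 / (2 * of_nat i)) ^ 3) + (1 / (of_nat p - 2 * of_nat i)) ^ 3)"
    unfolding sum_p_even_odd using p_eq
    by (intro sum.cong refl) (subst of_nat_p_diff, auto simp: minus_one_power_p_diff)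
  \<comment> \<open>The odd index \<open>p - 2 i\<close> changes sign through parity and again
    through the cube, so it doubles the term of \<open>2 i\<close>; the total is
    \<open>-2 H_3 / 8\<close>.\<close>
  also have "pcong 1 \<dots> (\<Sum>i=1..half. - ((1 / (2 * of_nat i)) ^ 3) + (- (1 / (2 * of_nat i))) ^ 3)"
  proof (intro pcong_sum pcong_add pcong_refl)
    fix i assume "i \<in> {1..half}"
    hence u: "p_unit (2 * of_nat i)" using p_unit_index by auto
    show "pcong 1 ((1 / (of_nat p - 2 * of_nat i)) ^ 3) ((- (1 / (2 * of_nat i))) ^ 3)"
      unfolding power3_eq_cube using u p_unit_p_sub[OF u]
      by (intro pcong_mult pcong_reflect p_integral_mult) auto
  qed
  also have "\<dots> = - gharm 3 half / 4"
    unfolding gharm_def sum_negf[symmetric] sum_divide_distrib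
    by (intro sum.cong refl) (simp add: power_divide power_mult_distrib)
  finally show ?thesis unfolding R_def by simp
qed

text \<open>Both sides of \<open>triangle_sum_reflect\<close> are evaluated. With sign
  \<open>(- 1) ^ i\<close> only even \<open>n = 2 m\<close> survive and give
  \<open>-X/2 - H_3/4\<close>; with sign \<open>(- 1) ^ n\<close> the sum is congruent to
  \<open>-H_3/4\<close>. Thus \<open>-X/2 - H_3/4 \<equiv> H_3/4\<close>.\<close>

lemma double_sum_cong:
  "pcong 1 (\<Sum>m=1..half. (gharm 1 (2 * m) - gharm 1 m) / of_nat m ^ 2) (- gharm 3 half)"
proof -
  define X where "X = (\<Sum>m=1..half. (gharm 1 (2 * m) - gharm 1 m) / of_nat m ^ 2)"
  define a where "a = (\<lambda>n. \<Sum>i\<in>{1..<n}. (- 1) ^ i / of_nat i :: rat)"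
  have "(\<Sum>n=1..p - 1. \<Sum>i\<in>{1..<n}. (- 1) ^ i / (of_nat i * of_nat (n - i) * of_nat n)) =
      (\<Sum>n=1..p - 1. (1 + (- 1) ^ n) * a n / of_nat n ^ 2)"
    unfolding partial_fraction_sum
  proof (rule sum.cong)
    fix n
    have "(\<Sum>i\<in>{1..<n}. ((- 1) ^ i + (- 1) ^ (n - i)) / of_nat i) = (1 + (- 1) ^ n) * a n"
      unfolding a_def sum_distrib_left
      by (intro sum.cong refl) (auto simp: uminus_power_if)
    thus "(\<Sum>i\<in>{1..<n}. ((- 1) ^ i + (- 1) ^ (n - i)) / of_nat i) / of_nat n ^ 2 = (1 + (- 1) ^ n) * a n / of_nat n ^ 2"
      by simp
  qed simp
  also have "\<dots> = (\<Sum>m=1..half. a (2 * m) / (2 * of_nat m ^ 2))"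
    unfolding sum_p_even_odd using p_eq
    by (intro sum.cong refl) (auto simp: minus_one_power_p_diff power_mult_distrib)
  also have "\<dots> = (\<Sum>m=1..half. - 1 / 2 * ((gharm 1 (2 * m) - gharm 1 m) / of_nat m ^ 2) - 1 / 4 * (1 / of_nat m ^ 3))"
  proof (rule sum.cong)
    fix m assume m: "m \<in> {1..half}"
    have "{1..2 * m} = insert (2 * m) {1..<2 * m}" using m by auto
    hence "(\<Sum>i=1..2 * m. (- 1) ^ i / of_nat i) = a (2 * m) + (1 / (2 * of_nat m) :: rat)"
      by (simp add: a_def)
    hence a: "a (2 * m) = gharm 1 m - gharm 1 (2 * m) - 1 / (2 * of_nat m)"
      unfolding sum_alternating_reciprocals by simp
    show "a (2 * m) / (2 * of_nat m ^ 2) =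
        - 1 / 2 * ((gharm 1 (2 * m) - gharm 1 m) / of_nat m ^ 2) - 1 / 4 * (1 / of_nat m ^ 3)"
      unfolding a by (simp add: diff_divide_distrib add_divide_distrib power2_eq_square power3_eq_cube)
  qed simp
  also have "\<dots> = - 1 / 2 * X - 1 / 4 * gharm 3 half"
    by (simp only: X_def gharm_def sum_subtractf sum_distrib_left)
  finally have 1: "(\<Sum>n=1..p - 1. \<Sum>i\<in>{1..<n}. (- 1) ^ i / (of_nat i * of_nat (n - i) * of_nat n)) =
    - 1 / 2 * X - 1 / 4 * gharm 3 half" .
  have 2: "(\<Sum>n=1..p - 1. \<Sum>i\<in>{1..<n}. (- 1) ^ n / (of_nat i * of_nat (n - i) * of_nat n)) =
    2 * (\<Sum>n=1..p - 1. (- 1) ^ n * gharm 1 (n - 1) / of_nat n ^ 2)"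
    unfolding partial_fraction_sum sum_distrib_left
  proof (rule sum.cong)
    fix n assume "n \<in> {1..p - 1}"
    hence "{1..<n} = {1..n - 1}" by auto
    hence "(\<Sum>i\<in>{1..<n}. ((- 1) ^ n + (- 1) ^ n) / of_nat i) = 2 * ((- 1) ^ n * gharm 1 (n - 1))"
      unfolding gharm_def sum_distrib_left by (intro sum.cong) simp_all
    thus "(\<Sum>i\<in>{1..<n}. ((- 1) ^ n + (- 1) ^ n) / of_nat i) / of_nat n ^ 2 = 2 * ((- 1) ^ n * gharm 1 (n - 1) / of_nat n ^ 2)"
      by simp
  qed simp
  have "pcong 1 (- 1 / 2 * X - 1 / 4 * gharm 3 half) (- (- gharm 3 half / 4))"
    using pcong_trans[OF triangle_sum_reflect[unfolded 1 2] pcong_minus[OF alternating_gharm_sum_cong]] .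
  hence "pcong 1 (- 2 * ((- 1 / 2 * X - 1 / 4 * gharm 3 half) + 1 / 4 * gharm 3 half)) (- 2 * (- (- gharm 3 half / 4) + 1 / 4 * gharm 3 half))"
    by (intro pcong_cmult pcong_add pcong_refl) auto
  thus ?thesis unfolding X_def[symmetric] by simp
qed

end

section \<open>Bernoulli numbers\<close>

text \<open>For \<open>n = p - 1\<close> the factors are \<open>1 - p/i\<close>, ready for expansion
  in powers of \<open>p\<close>.\<close>

lemma binomial_prod_one_minus:
  "(of_nat (n choose k) :: rat) = (- 1) ^ k * (\<Prod>i=1..k. 1 - of_nat (Suc n) / of_nat i)"
proof (induction k)
  case (Suc k)
  have "of_nat (Suc k) * (of_nat n gchoose Suc k) = (of_nat n - of_nat k) * (of_nat n gchoose k :: rat)"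
    using gbinomial_mult_1[of "of_nat n :: rat" k] by (simp add: algebra_simps)
  hence "of_nat (Suc k) * (of_nat (n choose Suc k) :: rat) = (of_nat n - of_nat k) * of_nat (n choose k)"
    by (simp add: binomial_gbinomial)
  hence "(of_nat (n choose Suc k) :: rat) = of_nat (n choose k) * ((of_nat n - of_nat k) / of_nat (Suc k))"
    by (simp add: field_simps del: of_nat_Suc)
  also have "(of_nat n - of_nat k) / of_nat (Suc k) = - (1 - of_nat (Suc n) / of_nat (Suc k) :: rat)"
    by (simp add: field_simps)
  finally have "(of_nat (n choose Suc k) :: rat) = of_nat (n choose k) * - (1 - of_nat (Suc n) / of_nat (Suc k))" .
  moreover have "(\<Prod>i=1..Suc k. f i) = (\<Prod>i=1..k. f i) * f (Suc k)" for f :: "nat \<Rightarrow> rat" by simp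
  moreover have "(s * r) * - w = (- 1 * s) * (r * w)" for s r w :: rat by simp
  ultimately show ?case by (simp only: Suc.IH power_Suc)
qed simp

text \<open>Generating function of \<open>B_q(1/2) = (2^(1-q) - 1) B_q\<close>. It follows from
  \<open>e^x - 1 = (e^(x/2) - 1) (e^(x/2) + 1)\<close> after multiplication by
  \<open>e^x - 1\<close>.\<close>

lemma bernoulli_fps_half:
  defines "b \<equiv> Abs_fps (\<lambda>n. bernoulli n / fact n)"
  shows "fps_const 2 * (b oo (fps_const (1 / 2) * fps_X)) - b = b * fps_exp (1 / 2)"
proof -
  define e where "e = fps_exp (1 / 2 :: rat)"
  define h where "h = b oo (fps_const (1 / 2) * fps_X)"
  have E: "fps_exp 1 - 1 = (e - 1) * (e + 1)"
    using fps_exp_add_mult[of "1 / 2 :: rat" "1 / 2"] by (simp add: e_def algebra_simps)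
  have "h * (e - 1) = (b * (fps_exp 1 - 1)) oo (fps_const (1 / 2) * fps_X)"
    unfolding h_def e_def
    by (subst fps_compose_mult_distrib) (simp_all add: fps_compose_sub_distrib fps_exp_compose_linear)
  also have "\<dots> = fps_const (1 / 2) * fps_X"
    unfolding b_def bernoulli_egf by simp
  finally have h: "h * (e - 1) = fps_const (1 / 2) * fps_X" .
  have "(fps_const 2 * h - b) * (fps_exp 1 - 1) = fps_const 2 * (h * (e - 1)) * (e + 1) - b * (fps_exp 1 - 1)"
    unfolding E by (simp add: algebra_simps)
  also have "\<dots> = fps_X * (e + 1) - fps_X"
    unfolding h b_def bernoulli_egf by (simp add: mult.assoc[symmetric])
  also have "\<dots> = (b * e) * (fps_exp 1 - 1)"
    using bernoulli_egf unfolding b_def by (simp add: algebra_simps)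
  finally have "(fps_const 2 * h - b) * (fps_exp 1 - 1) = (b * e) * (fps_exp 1 - 1)" .
  moreover have "fps_exp 1 - 1 \<noteq> (0 :: rat fps)"
    using bernoulli_egf by auto
  ultimately show ?thesis unfolding h_def e_def by simp
qed

text \<open>The left side is the Bernoulli polynomial of index \<open>q\<close> at
  \<open>1/2\<close>, divided by \<open>q!\<close>.\<close>

lemma bernoulli_half_point:
  "(\<Sum>i=0..q. bernoulli i / fact i * ((1 / 2) ^ (q - i) / fact (q - i))) =
     (2 * (1 / 2) ^ q - 1) * (bernoulli q / fact q)"
proof -
  have "fps_nth (Abs_fps (\<lambda>n. bernoulli n / fact n) * fps_exp (1 / 2)) q =
    fps_nth (fps_const 2 * (Abs_fps (\<lambda>n. bernoulli n / fact n) oo (fps_const (1 / 2) * fps_X)) - Abs_fps (\<lambda>n. bernoulli n / fact n)) q"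
    by (simp only: bernoulli_fps_half)
  thus ?thesis by (simp add: fps_mult_nth[of _ "fps_exp (1 / 2)"] left_diff_distrib diff_divide_distrib)
qed

text \<open>Faulhaber's formula divided by \<open>q!\<close>. The geometric sum of exponentials
  times \<open>e^x - 1\<close> telescopes; multiplying by \<open>b\<close> turns
  \<open>e^x - 1\<close> into \<open>x\<close>, which moves the coefficient to index
  \<open>q + 1\<close>.\<close>

lemma power_sum_bernoulli:
  "(\<Sum>k<M. of_nat k ^ q / fact q) =
    (\<Sum>i=0..Suc q. bernoulli i / fact i * (of_nat M ^ (Suc q - i) / fact (Suc q - i))) - bernoulli (Suc q) / fact (Suc q)"
proof -
  define b where "b = Abs_fps (\<lambda>n. bernoulli n / fact n)"
  have "(\<Sum>k<M. fps_exp (of_nat k)) * (fps_exp 1 - 1) = fps_exp (of_nat M) - (1 :: rat fps)"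
    by (induction M) (simp_all add: algebra_simps fps_exp_add_mult)
  hence "(\<Sum>k<M. fps_exp (of_nat k)) * (b * (fps_exp 1 - 1)) = b * (fps_exp (of_nat M) - 1)"
    by (metis mult.left_commute)
  hence "(\<Sum>k<M. fps_exp (of_nat k)) * fps_X = b * fps_exp (of_nat M) - b"
    unfolding b_def bernoulli_egf by (simp add: algebra_simps)
  hence "fps_nth ((\<Sum>k<M. fps_exp (of_nat k)) * fps_X) (Suc q) = fps_nth (b * fps_exp (of_nat M) - b) (Suc q)"
    by simp
  thus ?thesis by (simp add: fps_mult_nth[of b] fps_sum_nth) (simp add: b_def)
qed

lemma bernoulli_recurrence:
  assumes "n > 0"
  shows "bernoulli n / fact n = - (\<Sum>i<n. bernoulli i / fact i / fact (Suc n - i))"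
proof -
  have "0 = fps_nth (Abs_fps (\<lambda>n. bernoulli n / fact n) * (fps_exp 1 - 1)) (Suc n)"
    unfolding bernoulli_egf using assms by simp
  also have "\<dots> = (\<Sum>i=0..n. bernoulli i / fact i / fact (Suc n - i))"
    unfolding fps_mult_nth sum.atLeast0_atMost_Suc by (auto intro!: sum.cong)
  also have "\<dots> = (\<Sum>i<n. bernoulli i / fact i / fact (Suc n - i)) + bernoulli n / fact n"
    by (simp add: atLeast0AtMost lessThan_Suc_atMost[symmetric])
  finally show ?thesis by simp
qed

lemma bernoulli_0: "bernoulli 0 = 1"
proof -
  have "1 = fps_nth (Abs_fps (\<lambda>n. bernoulli n / fact n) * (fps_exp 1 - 1)) 1"
    unfolding bernoulli_egf by simp
  thus ?thesis unfolding fps_mult_nth by simp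
qed

section \<open>Bernoulli numbers modulo \<open>p\<close> and the sum of inverse cubes\<close>

context prime_gt_3
begin

lemma p_unit_fact: "n < p \<Longrightarrow> p_unit (fact n)"
  by (induction n) (auto intro!: p_unit_mult simp: p_unit_of_nat simp del: of_nat_Suc)

text \<open>The recurrence divides only by factorials of numbers up to \<open>n + 1\<close>, which
  are units as long as \<open>n + 1 < p\<close>.\<close>

lemma bernoulli_over_fact_integral: "n + 1 < p \<Longrightarrow> p_integral p (bernoulli n / fact n)"
proof (induction n rule: less_induct)
  case (less n)
  show ?case
  proof (cases "n = 0")
    case False
    show ?thesis unfolding bernoulli_recurrence[OF False[unfolded neq0_conv]]
      using less by (intro p_integral_minus p_integral_sum p_integral_divide[of _ "fact (Suc n - _)"] p_unit_fact) auto
  qed (simp add: bernoulli_0)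
qed

lemma pcong_power: "pcong m a b \<Longrightarrow> p_integral p a \<Longrightarrow> p_integral p b \<Longrightarrow> pcong m (a ^ n) (b ^ n)"
  by (induction n) (auto intro!: pcong_mult)

lemma pcong_power_p: "pcong 1 (of_nat k ^ p) (of_nat k)"
proof (induction k)
  case 0
  show ?case using p_gt_3 by (simp add: zero_power)
next
  case (Suc k)
  define f where "f = (\<lambda>i. of_nat (p choose i) * of_nat k ^ i :: rat)"
  have "(of_nat k + 1) ^ p = (\<Sum>i\<le>p. f i)"
    using binomial_ring[of "of_nat k :: rat" 1 p] by (simp add: f_def)
  also have "{..p} = insert 0 (insert p {1..<p})" using p_gt_3 by auto
  also have "sum f \<dots> = 1 + (of_nat k ^ p + sum f {1..<p})"
    using p_gt_3 by (subst sum.insert; simp add: f_def)+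
  also have "pcong 1 \<dots> (1 + (of_nat k + (\<Sum>i\<in>{1..<p}. 0)))"
  proof (intro pcong_add pcong_refl Suc.IH pcong_sum)
    fix i assume "i \<in> {1..<p}"
    hence "p dvd p choose i" using prime_p by (intro dvd_choose_prime) auto
    then obtain c where "p choose i = p * c" by blast
    thus "pcong 1 (f i) 0"
      by (intro pcongI[of "of_nat c * of_nat k ^ i"]) (auto simp: f_def)
  qed
  finally show ?case by (simp add: add.commute)
qed

lemma pcong_fermat:
  assumes "0 < k" "k < p"
  shows "pcong 1 (of_nat k ^ (p - 1)) 1"
proof -
  have u: "p_unit (of_nat k)" using assms by (rule p_unit_of_nat)
  have "pcong 1 (1 / of_nat k * of_nat k ^ p) (1 / of_nat k * of_nat k)"
    using u by (intro pcong_cmult pcong_power_p) auto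
  moreover have "(of_nat k :: rat) ^ p = of_nat k * of_nat k ^ (p - 1)"
    using p_gt_3 by (metis One_nat_def Suc_pred gr_implies_not0 neq0_conv power_Suc)
  ultimately show ?thesis using p_unit_nonzero[OF u] by simp
qed

text \<open>By Fermat \<open>1/k^3 \<equiv> k^(p-4)\<close>, so \<open>H_3\<close> is a power sum.
  Faulhaber's formula has upper limit \<open>M = half + 1 \<equiv> 1/2\<close>, where the Bernoulli
  polynomial is known.\<close>

lemma gharm_3_half_cong: "pcong 1 (gharm 3 half) (- 2 * bernoulli (p - 3))"
proof -
  define q where "q = p - 4"
  have q: "Suc q = p - 3" "q + 4 = p" using p_gt_3 by (auto simp: q_def)
  define M where "M = half + 1"
  define \<beta> where "\<beta> = (\<lambda>i. bernoulli i / fact i)"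
  have M: "pcong 1 (of_nat M) (1 / 2)"
  proof (rule pcongI[of "1 / 2"])
    have "(of_nat p :: rat) = of_nat (2 * half + 1)" using p_eq by simp
    thus "of_nat M - 1 / 2 = of_nat p ^ 1 * (1 / 2 :: rat)" by (simp add: M_def)
  qed auto
  have \<beta>: "p_integral p (\<beta> i)" if "i \<le> Suc q" for i
    unfolding \<beta>_def using that q by (intro bernoulli_over_fact_integral) auto
  have "(\<Sum>k<M. of_nat k ^ q / fact q) =
     (\<Sum>i=0..Suc q. \<beta> i * (of_nat M ^ (Suc q - i) / fact (Suc q - i))) - \<beta> (Suc q)"
    unfolding \<beta>_def by (rule power_sum_bernoulli)
  also have "pcong 1 \<dots> ((\<Sum>i=0..Suc q. \<beta> i * ((1 / 2) ^ (Suc q - i) / fact (Suc q - i))) - \<beta> (Suc q))"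
  proof (intro pcong_diff pcong_refl pcong_sum pcong_cmult \<beta>)
    fix i assume "i \<in> {0..Suc q}"
    have "pcong 1 (1 / fact (Suc q - i) * of_nat M ^ (Suc q - i)) (1 / fact (Suc q - i) * (1 / 2) ^ (Suc q - i))"
      using q by (intro pcong_cmult pcong_power M p_integral_divide p_unit_fact) auto
    thus "pcong 1 (of_nat M ^ (Suc q - i) / fact (Suc q - i)) ((1 / 2) ^ (Suc q - i) / fact (Suc q - i))"
      by simp
  qed auto
  also have "\<dots> = (2 * (1 / 2) ^ Suc q - 2) * \<beta> (Suc q)"
  proof -
    have "(2 * h - 1) * x - x = (2 * h - 2) * x" for h x :: rat by (simp add: algebra_simps)
    thus ?thesis unfolding \<beta>_def bernoulli_half_point .
  qed
  \<comment> \<open>Here \<open>2^(-(p-3)) = 4 / 2^(p-1) \<equiv> 4\<close>, and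
    \<open>2 * 4 - 2 = 6\<close>.\<close>
  also have "pcong 1 \<dots> (6 * \<beta> (Suc q))"
  proof -
    have "pcong 1 (1 / 2 ^ (p - 1)) (1 / 1)"
      using pcong_fermat[of 2] p_gt_3 by (intro pcong_inverse) auto
    hence "pcong 1 (8 * (1 / 2 ^ (p - 1)) - 2) (8 * (1 / 1) - 2)"
      by (intro pcong_diff pcong_cmult pcong_refl) auto
    moreover have "2 ^ (p - 1) = (4 * 2 ^ Suc q :: rat)"
    proof -
      have "p - 1 = 2 + Suc q" using q(2) by simp
      thus ?thesis by (simp only: power_add) simp
    qed
    ultimately have "pcong 1 (2 * (1 / 2) ^ Suc q - 2) 6" by (simp add: power_one_over)
    hence "pcong 1 (\<beta> (Suc q) * (2 * (1 / 2) ^ Suc q - 2)) (\<beta> (Suc q) * 6)"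
      by (intro pcong_cmult \<beta>) auto
    thus ?thesis by (simp add: mult.commute)
  qed
  finally have 1: "pcong 1 (\<Sum>k<M. of_nat k ^ q / fact q) (6 * \<beta> (Suc q))" .
  have "pcong 1 (fact q * (\<Sum>k<M. of_nat k ^ q / fact q)) (fact q * (6 * \<beta> (Suc q)))"
    using q by (intro pcong_cmult[OF 1] p_unit_integral p_unit_fact) auto
  moreover have "fact q * (\<Sum>k<M. of_nat k ^ q / fact q) = (\<Sum>k<M. of_nat k ^ q :: rat)"
    by (simp add: sum_distrib_left)
  moreover have "fact q * (6 * \<beta> (Suc q)) = 6 * bernoulli (p - 3) * (1 / of_nat (Suc q))"
    by (simp add: \<beta>_def q(1)[symmetric] del: of_nat_Suc)
  ultimately have 2: "pcong 1 (\<Sum>k<M. of_nat k ^ q) (6 * bernoulli (p - 3) * (1 / of_nat (Suc q)))"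
    by simp
  have B: "p_integral p (bernoulli (p - 3))"
  proof -
    have "p_integral p (fact (Suc q) * \<beta> (Suc q))"
      using q by (intro p_integral_mult \<beta> p_unit_integral p_unit_fact) auto
    thus ?thesis by (simp add: \<beta>_def q(1))
  qed
  \<comment> \<open>Dividing \<open>q!\<close> by \<open>(q+1)!\<close> left
    \<open>1/(p - 3)\<close>, which is congruent to \<open>-1/3\<close>; so the coefficient 6
    becomes -2.\<close>
  have "pcong 1 (1 / of_nat (Suc q)) (1 / (- 3))"
  proof (rule pcong_inverse)
    show "pcong 1 (of_nat (Suc q)) (- 3)"
    proof (rule pcongI[OF p_integral_1])
      have "(of_nat p :: rat) = of_nat (q + 4)" using q(2) by simp
      thus "of_nat (Suc q) - - 3 = (of_nat p ^ 1 * 1 :: rat)" by simp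
    qed
    show "p_unit (of_nat (Suc q))" using q by (intro p_unit_of_nat) auto
    show "p_unit (- 3)" by (intro p_unit_minus p_unit_numerals)
  qed
  hence "pcong 1 (6 * bernoulli (p - 3) * (1 / of_nat (Suc q))) (6 * bernoulli (p - 3) * (1 / (- 3)))"
    using B by (intro pcong_cmult) auto
  moreover have "6 * bernoulli (p - 3) * (1 / (- 3)) = - 2 * bernoulli (p - 3)" by simp
  ultimately have 3: "pcong 1 (\<Sum>k<M. of_nat k ^ q) (- 2 * bernoulli (p - 3))"
    using pcong_trans[OF 2] by (simp only:)
  have "(\<Sum>k<M. of_nat k ^ q) = (\<Sum>k=1..half. of_nat k ^ q :: rat)"
  proof (rule sum.mono_neutral_right)
    \<comment> \<open>For \<open>q = 0\<close> the term \<open>k = 0\<close> would contribute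
      \<open>0^0 = 1\<close>.\<close>
    have "q \<noteq> 0" using q odd_p by (metis even_numeral add_0)
    thus "\<forall>i\<in>{..<M} - {1..half}. (of_nat i :: rat) ^ q = 0" by (auto simp: M_def)
  qed (auto simp: M_def)
  also have "pcong 1 \<dots> (gharm 3 half)"
    unfolding gharm_def
  proof (rule pcong_sum)
    fix k assume k: "k \<in> {1..half}"
    hence k': "0 < k" "k < p" using p_eq by auto
    have u: "p_unit (of_nat k)" by (rule p_unit_index[OF k])
    have "pcong 1 (1 / of_nat k ^ 3 * of_nat k ^ (p - 1)) (1 / of_nat k ^ 3 * 1)"
      using u by (intro pcong_cmult pcong_fermat k' p_integral_divide p_unit_power) auto
    moreover have "(of_nat k :: rat) ^ (p - 1) = of_nat k ^ 3 * of_nat k ^ q"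
    proof -
      have "p - 1 = 3 + q" using q(2) by simp
      thus ?thesis by (simp only: power_add)
    qed
    ultimately show "pcong 1 (of_nat k ^ q) (1 / of_nat k ^ 3)" using u k' by simp
  qed
  finally show ?thesis using pcong_trans[OF pcong_sym 3] by blast
qed

lemma bernoulli_integral: "p_integral p (bernoulli (p - 3))"
proof -
  have "p_integral p (fact (p - 3) * (bernoulli (p - 3) / fact (p - 3)))"
    using p_gt_3 by (intro p_integral_mult bernoulli_over_fact_integral p_unit_integral p_unit_fact) auto
  thus ?thesis by simp
qed

end

section \<open>The supercongruence\<close>

context prime_gt_3
begin

text \<open>The binomial coefficient and the quotient each contribute a factor \<open>p\<close>, so
  the remaining product \<open>A * B * C\<close> is needed only modulo \<open>p^2\<close>. There its
  first-order coefficients \<open>a\<close>, \<open>b\<close>, \<open>c\<close> simply add.\<close>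

lemma summand_cong:
  assumes m: "m \<in> {1..half}"
  shows "pcong 4 (of_nat (p choose (2 * m)) * (of_nat p / (of_nat p - 4 * of_nat m) *
      (\<Prod>i<m. (of_nat p + 4 * of_nat i + 2) / (4 * of_nat i + 2 - 3 * of_nat p))))
    (of_nat p ^ 2 * (1 / (8 * of_nat m ^ 2) *
      (1 + of_nat p ^ 1 * (gharm 1 (2 * m) - gharm 1 m + 3 / (4 * of_nat m)))))"
proof -
  define P :: rat where "P = of_nat p"
  define x :: rat where "x = of_nat m"
  have x: "p_unit x" unfolding x_def by (rule p_unit_index[OF m])
  have P [simp, intro]: "p_integral p P" by (simp add: P_def)
  have u4: "p_unit (4 * x - P)" unfolding P_def by (rule p_unit_sub_p) (use x in auto)
  have odd_unit: "p_unit (2 * of_nat i + 1)" "p_unit (4 * of_nat i + 2 - 3 * P)" if "i < m" for i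
  proof -
    have "p_unit (of_nat (2 * i + 1))" using m that p_eq by (intro p_unit_of_nat) auto
    thus u: "p_unit (2 * of_nat i + 1)" by (simp add: add.commute)
    have "p_unit (2 * (2 * of_nat i + 1) + of_nat p * (- 3))"
      using u by (intro p_unit_add_p_mult p_unit_mult) auto
    thus "p_unit (4 * of_nat i + 2 - 3 * P)" by (simp add: P_def algebra_simps)
  qed
  define A where "A = (\<Prod>i=1..2 * m - 1. 1 + P ^ 1 * (- (1 / of_nat i)))"
  define B where "B = 1 + P ^ 1 * (1 / (4 * x - P))"
  define C where "C = (\<Prod>i<m. 1 + P ^ 1 * (4 / (4 * of_nat i + 2 - 3 * P)))"
  define a where "a = - gharm 1 (2 * m - 1)"
  define b where "b = 1 / (4 * x)"
  define c where "c = (\<Sum>i<m. 2 / (2 * of_nat i + 1 :: rat))"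
  \<comment> \<open>Absorption gives \<open>p/(2m)\<close> times the binomial coefficient
    \<open>p - 1\<close> over \<open>2 m - 1\<close>; the minus sign arises because
    \<open>2 m - 1\<close> is odd, and it cancels against the one in \<open>quot\<close>.\<close>
  have bin: "of_nat (p choose (2 * m)) = - (P / (2 * x)) * A"
  proof -
    define k where "k = 2 * m - 1"
    have k: "2 * m = Suc k" "odd k" "p = Suc (p - 1)" using m p_gt_3 by (auto simp: k_def)
    have "Suc k * (Suc (p - 1) choose Suc k) = Suc (p - 1) * ((p - 1) choose k)"
      by (rule Suc_times_binomial)
    hence "of_nat (Suc k * (p choose Suc k)) = (of_nat (p * ((p - 1) choose k)) :: rat)"
      using k(3) by simp
    hence "of_nat (Suc k) * of_nat (p choose Suc k) = P * (of_nat ((p - 1) choose k) :: rat)"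
      by (simp only: of_nat_mult P_def)
    moreover have "of_nat ((p - 1) choose k) = - A"
      unfolding binomial_prod_one_minus k(3)[symmetric] using k(2)
      by (simp add: A_def k_def P_def)
    moreover have "of_nat (Suc k) = 2 * x" unfolding k(1)[symmetric] by (simp add: x_def)
    ultimately have "2 * x * of_nat (p choose (2 * m)) = - P * A" unfolding k(1) by simp
    thus ?thesis using p_unit_nonzero[OF x] by (simp add: field_simps)
  qed
  have quot: "P / (P - 4 * x) = - (P / (4 * x)) * B"
    using p_unit_nonzero[OF u4] p_unit_nonzero[OF x] by (simp add: B_def divide_simps) (simp add: algebra_simps)
  have prd: "(\<Prod>i<m. (P + 4 * of_nat i + 2) / (4 * of_nat i + 2 - 3 * P)) = C"
    unfolding C_def
    by (intro prod.cong refl) (use odd_unit(2)[THEN p_unit_nonzero] in \<open>simp add: field_simps\<close>)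
  have exact: "of_nat (p choose (2 * m)) * (P / (P - 4 * x) *
      (\<Prod>i<m. (P + 4 * of_nat i + 2) / (4 * of_nat i + 2 - 3 * P))) = P ^ 2 * (1 / (8 * x ^ 2) * (A * (B * C)))"
    unfolding bin quot prd by (simp add: power2_eq_square)
  have Ic: "p_integral p c" unfolding c_def using odd_unit by (intro p_integral_sum p_integral_divide) auto
  have Ia: "p_integral p a" unfolding a_def using m p_eq by (intro p_integral_minus gharm_integral) auto
  have Ib: "p_integral p b" unfolding b_def using x by (intro p_integral_divide p_unit_mult) auto
  have cA: "pcong 2 A (1 + P ^ 1 * a)"
  proof -
    have "pcong (2 * 1) A (1 + P ^ 1 * (\<Sum>i=1..2 * m - 1. - (1 / of_nat i)))"
      unfolding A_def P_def using m p_eq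
      by (intro pcong_prod_one_plus p_integral_minus p_integral_divide p_unit_of_nat) auto
    thus ?thesis by (simp add: a_def gharm_def sum_negf)
  qed
  have cB: "pcong 2 B (1 + P ^ 1 * b)"
  proof -
    have "pcong 1 (1 / (4 * x - P)) b"
      unfolding b_def by (rule pcong_inverse[OF pcongI[of "- 1"]]) (use u4 x in \<open>auto simp: P_def\<close>)
    hence "pcong (1 + 1) (P ^ 1 * (1 / (4 * x - P))) (P ^ 1 * b)"
      unfolding P_def by (rule pcong_scale)
    hence "pcong 2 (P ^ 1 * (1 / (4 * x - P))) (P ^ 1 * b)" by (simp only: one_add_one)
    thus ?thesis unfolding B_def by (intro pcong_add pcong_refl)
  qed
  have cC: "pcong 2 C (1 + P ^ 1 * c)"
  proof -
    have "pcong (2 * 1) C (1 + P ^ 1 * (\<Sum>i<m. 4 / (4 * of_nat i + 2 - 3 * P)))"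
      unfolding C_def P_def
      by (intro pcong_prod_one_plus p_integral_divide) (use odd_unit(2) in \<open>auto simp: P_def\<close>)
    moreover have "pcong 1 (\<Sum>i<m. 4 / (4 * of_nat i + 2 - 3 * P)) c"
      unfolding c_def
    proof (rule pcong_sum)
      fix i assume "i \<in> {..<m}"
      hence u: "p_unit (2 * of_nat i + 1)" "p_unit (4 * of_nat i + 2 - 3 * P)" using odd_unit by auto
      have u2: "p_unit (2 * (2 * of_nat i + 1))" by (rule p_unit_mult[OF p_unit_numerals(1) u(1)])
      have "pcong 1 (1 / (4 * of_nat i + 2 - 3 * P)) (1 / (2 * (2 * of_nat i + 1)))"
        by (rule pcong_inverse[OF pcongI[of "- 3"] u(2) u2]) (auto simp: P_def algebra_simps)
      hence "pcong 1 (4 * (1 / (4 * of_nat i + 2 - 3 * P))) (4 * (1 / (2 * (2 * of_nat i + 1))))"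
        by (rule pcong_cmult) auto
      moreover have e: "4 / y = 4 * (1 / y)" "2 / y = 4 * (1 / (2 * y))" for y :: rat by simp_all
      ultimately show "pcong 1 (4 / (4 * of_nat i + 2 - 3 * P)) (2 / (2 * of_nat i + 1))"
        unfolding e(1)[of "4 * of_nat i + 2 - 3 * P"] e(2)[of "2 * of_nat i + 1"] by blast
    qed
    hence "pcong (1 + 1) (1 + P ^ 1 * (\<Sum>i<m. 4 / (4 * of_nat i + 2 - 3 * P))) (1 + P ^ 1 * c)"
      unfolding P_def by (intro pcong_add pcong_refl pcong_scale)
    ultimately show ?thesis unfolding one_add_one mult_1_right by (rule pcong_trans)
  qed
  have bc: "pcong 2 (B * C) ((1 + P ^ 1 * b) * (1 + P ^ 1 * c))"
    using Ib Ic by (intro pcong_mult cB cC pcong_integral[OF cC]) auto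
  have "p_integral p (B * C)" by (rule pcong_integral[OF bc]) (use Ib Ic in auto)
  hence "pcong 2 (A * (B * C)) ((1 + P ^ 1 * a) * ((1 + P ^ 1 * b) * (1 + P ^ 1 * c)))"
    using Ia by (intro pcong_mult[OF cA bc]) auto
  also have "pcong 2 ((1 + P ^ 1 * a) * ((1 + P ^ 1 * b) * (1 + P ^ 1 * c))) (1 + P ^ 1 * (a + b + c))"
  proof (rule pcongI)
    show "p_integral p (a * b + a * c + b * c + P * (a * (b * c)))"
      using Ia Ib Ic by (intro p_integral_add p_integral_mult P)
    show "(1 + P ^ 1 * a) * ((1 + P ^ 1 * b) * (1 + P ^ 1 * c)) - (1 + P ^ 1 * (a + b + c)) =
        of_nat p ^ 2 * (a * b + a * c + b * c + P * (a * (b * c)))"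
      unfolding P_def[symmetric] power_one_right by (simp add: power2_eq_square algebra_simps)
  qed
  finally have "pcong (2 + 2) (P ^ 2 * (1 / (8 * x ^ 2) * (A * (B * C)))) (P ^ 2 * (1 / (8 * x ^ 2) * (1 + P ^ 1 * (a + b + c))))"
    unfolding P_def using x by (intro pcong_scale pcong_cmult p_integral_divide p_unit_mult p_unit_power) auto
  \<comment> \<open>Use \<open>H_(2m-1) = H_(2m) - 1/(2m)\<close> and
    \<open>c = 2 H_(2m) - H_m\<close>.\<close>
  moreover have "a + b + c = gharm 1 (2 * m) - gharm 1 m + 3 / (4 * x)"
  proof -
    have "2 * m = Suc (2 * m - 1)" using m by auto
    hence "gharm 1 (2 * m) = gharm 1 (2 * m - 1) + 1 / (2 * x)"
      by (metis gharm_Suc of_nat_mult of_nat_numeral power_one_right x_def)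
    moreover have "c = 2 * (\<Sum>i<m. 1 / (2 * of_nat i + 1))" by (simp add: c_def sum_distrib_left)
    moreover have "1 / (2 * x) + 1 / (4 * x) = 3 / (4 * x)" using p_unit_nonzero[OF x] by (simp add: field_simps)
    ultimately show ?thesis unfolding sum_odd_reciprocals a_def b_def by simp
  qed
  ultimately show ?thesis unfolding exact[unfolded P_def x_def] by (simp add: P_def x_def)
qed

text \<open>The double sum \<open>X\<close> is congruent to \<open>-H_3\<close> modulo
  \<open>p\<close>, so the coefficient of \<open>H_3\<close> is
  \<open>-1 + 3/4 = -1/4\<close>.\<close>

lemma summand_sum_cong:
  "pcong 4 (\<Sum>m=1..half. of_nat (p choose (2 * m)) * (of_nat p / (of_nat p - 4 * of_nat m) *
      (\<Prod>i<m. (of_nat p + 4 * of_nat i + 2) / (4 * of_nat i + 2 - 3 * of_nat p))))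
    (of_nat p ^ 2 * (1 / 8 * (gharm 2 half - 1 / 4 * of_nat p * gharm 3 half)))"
  (is "pcong 4 ?S _")
proof -
  define X where "X = (\<Sum>m=1..half. (gharm 1 (2 * m) - gharm 1 m) / of_nat m ^ 2)"
  have "pcong 4 ?S (\<Sum>m=1..half. of_nat p ^ 2 * (1 / (8 * of_nat m ^ 2) *
      (1 + of_nat p ^ 1 * (gharm 1 (2 * m) - gharm 1 m + 3 / (4 * of_nat m)))))"
    by (rule pcong_sum) (rule summand_cong)
  also have "\<dots> = (\<Sum>m=1..half. of_nat p ^ 2 * (1 / 8 * (1 / of_nat m ^ 2 +
      of_nat p ^ 1 * ((gharm 1 (2 * m) - gharm 1 m) / of_nat m ^ 2 + 3 / 4 * (1 / of_nat m ^ 3)))))"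
  proof (rule sum.cong)
    fix m
    have "1 / (8 * x ^ 2) * (1 + r * (g + 3 / (4 * x))) = 1 / 8 * (1 / x ^ 2 + r * (g / x ^ 2 + 3 / 4 * (1 / x ^ 3)))"
      for x r g :: rat by (simp add: algebra_simps add_divide_distrib power2_eq_square power3_eq_cube)
    thus "of_nat p ^ 2 * (1 / (8 * of_nat m ^ 2) * (1 + of_nat p ^ 1 * (gharm 1 (2 * m) - gharm 1 m + 3 / (4 * of_nat m)))) =
      of_nat p ^ 2 * (1 / 8 * (1 / of_nat m ^ 2 +
      of_nat p ^ 1 * ((gharm 1 (2 * m) - gharm 1 m) / of_nat m ^ 2 + 3 / 4 * (1 / of_nat m ^ 3))))" by (simp only:)
  qed simp
  also have "\<dots> = of_nat p ^ 2 * (1 / 8 * (gharm 2 half + of_nat p ^ 1 * (X + 3 / 4 * gharm 3 half)))"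
    by (simp only: X_def gharm_def[of 2] gharm_def[of 3] sum.distrib sum_distrib_left[symmetric])
  also have "pcong 4 \<dots> (of_nat p ^ 2 * (1 / 8 * (gharm 2 half + of_nat p ^ 1 * (- gharm 3 half + 3 / 4 * gharm 3 half))))"
  proof -
    have "pcong (1 + 1) (of_nat p ^ 1 * (X + 3 / 4 * gharm 3 half)) (of_nat p ^ 1 * (- gharm 3 half + 3 / 4 * gharm 3 half))"
      unfolding X_def by (intro pcong_scale pcong_add pcong_refl double_sum_cong)
    hence "pcong 2 (of_nat p ^ 1 * (X + 3 / 4 * gharm 3 half)) (of_nat p ^ 1 * (- gharm 3 half + 3 / 4 * gharm 3 half))"
      by (simp only: one_add_one)
    note * = pcong_scale[OF pcong_cmult[OF pcong_add[OF pcong_refl this]]]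
    have "pcong (2 + 2) (of_nat p ^ 2 * (1 / 8 * (gharm 2 half + of_nat p ^ 1 * (X + 3 / 4 * gharm 3 half))))
       (of_nat p ^ 2 * (1 / 8 * (gharm 2 half + of_nat p ^ 1 * (- gharm 3 half + 3 / 4 * gharm 3 half))))"
      by (rule *) auto
    thus ?thesis by simp
  qed
  finally show ?thesis by (simp add: algebra_simps)
qed

text \<open>Since \<open>H_2\<close> is a multiple of \<open>p H_3\<close> modulo
  \<open>p^2\<close>, every correction of order \<open>p^2\<close> is really one of order
  \<open>p^3\<close>.\<close>

lemma one_plus_square_cong:
  assumes "pcong 4 y (1 + of_nat p ^ 2 * w)" "pcong 2 w (c * of_nat p * z)"
  shows "pcong 4 y (1 + of_nat p ^ 3 * (c * z))"
proof -
  have "pcong (2 + 2) (1 + of_nat p ^ 2 * w) (1 + of_nat p ^ 2 * (c * of_nat p * z))"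
    by (intro pcong_add pcong_refl pcong_scale assms)
  hence "pcong 4 (1 + of_nat p ^ 2 * w) (1 + of_nat p ^ 2 * (c * of_nat p * z))" by simp
  moreover have "of_nat p ^ 2 * (c * of_nat p * z) = of_nat p ^ 3 * (c * z)"
    by (simp add: power2_eq_square power3_eq_cube)
  ultimately show ?thesis using pcong_trans[OF assms(1)] by (simp only:)
qed

lemma one_plus_cube_mult_cong:
  assumes "pcong 4 y (1 + of_nat p ^ 3 * u)" "pcong 4 z (1 + of_nat p ^ 3 * v)" "p_integral p u" "p_integral p v"
  shows "pcong 4 (y * z) (1 + of_nat p ^ 3 * (u + v))"
proof -
  have "pcong 4 (y * z) ((1 + of_nat p ^ 3 * u) * (1 + of_nat p ^ 3 * v))"
    using assms by (intro pcong_mult pcong_integral[OF assms(2)]) auto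
  also have "pcong 4 \<dots> (1 + of_nat p ^ 3 * (u + v))"
    by (rule pcongI[of "of_nat p ^ 2 * (u * v)"])
       (use assms in \<open>auto simp: algebra_simps eval_nat_numeral intro!: p_integral_mult p_integral_power\<close>)
  finally show ?thesis .
qed

text \<open>Up to the sign and the factor \<open>p\<close>, the sum is a product of three factors
  \<open>1 + c p^3 H_3\<close> modulo \<open>p^4\<close>, with \<open>c\<close> equal to
  \<open>-1/24\<close>, \<open>7/96\<close> and \<open>-17/96\<close>. These add up to
  \<open>-7/48\<close>, and \<open>H_3 \<equiv> -2 B\<close> yields \<open>7/24\<close>. The factor
  \<open>p\<close> raises the precision to \<open>p^5\<close>.\<close>

lemma ramanujan_sum_cong:
  "pcong 5 (\<Sum>k\<le>half. (6 * of_nat k + 1) * wz_term 0 k)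
     (of_nat p * ((- 1) ^ half * (1 + of_nat p ^ 3 * (7 / 24 * bernoulli (p - 3)))))"
proof -
  define P :: rat where "P = of_nat p"
  define h where "h = gharm 3 half"
  have h: "p_integral p h" unfolding h_def by (rule gharm_half_integral)
  have H2: "pcong 2 (gharm 2 half) (- 7 / 6 * P * h)"
    unfolding P_def h_def by (rule gharm_2_half_cong)
  define V where "V = (\<Sum>m=1..half. of_nat (p choose (2 * m)) * (of_nat p / (of_nat p - 4 * of_nat m) *
      (\<Prod>i<m. (of_nat p + 4 * of_nat i + 2) / (4 * of_nat i + 2 - 3 * of_nat p))) :: rat)"
  \<comment> \<open>The sign is included so that \<open>g\<close> is congruent to 1;
    \<open>sq\<close> restores it at the end.\<close>
  define g where "g = (- 1) ^ half * (of_nat ((2 * half) choose half) / 16 ^ half :: rat)"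
  have sq: "(- 1) ^ half * ((- 1) ^ half * z) = z" for z :: rat
    by (simp add: mult.assoc[symmetric] power_mult_distrib[symmetric])
  have "pcong 4 g (1 + P ^ 2 * ((gharm 2 half + P * h) / 4))"
    using pcong_cmult[OF central_binomial_cong, of "(- 1) ^ half"] unfolding sq g_def P_def h_def by auto
  moreover have "pcong 2 ((gharm 2 half + P * h) / 4) (- 1 / 24 * P * h)"
  proof -
    have "pcong 2 (1 / 4 * (gharm 2 half + P * h)) (1 / 4 * (- 7 / 6 * P * h + P * h))"
      by (intro pcong_cmult pcong_add pcong_refl H2) auto
    thus ?thesis by (simp add: algebra_simps add_divide_distrib)
  qed
  ultimately have G: "pcong 4 g (1 + P ^ 3 * (- 1 / 24 * h))"
    unfolding P_def by (rule one_plus_square_cong)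
  have "pcong 4 (sine_prod half (P ^ 2)) (1 + P ^ 2 * (- gharm 2 half / 16))"
    unfolding P_def by (rule sine_prod_cong)
  moreover have "pcong 2 (- gharm 2 half / 16) (7 / 96 * P * h)"
  proof -
    have "pcong 2 (- 1 / 16 * gharm 2 half) (- 1 / 16 * (- 7 / 6 * P * h))"
      by (intro pcong_cmult H2) auto
    thus ?thesis by simp
  qed
  ultimately have Q: "pcong 4 (sine_prod half (P ^ 2)) (1 + P ^ 3 * (7 / 96 * h))"
    unfolding P_def by (rule one_plus_square_cong)
  have "pcong 4 (1 + V) (1 + P ^ 2 * (1 / 8 * (gharm 2 half - 1 / 4 * P * h)))"
    unfolding V_def P_def h_def by (intro pcong_add pcong_refl summand_sum_cong)
  moreover have "pcong 2 (1 / 8 * (gharm 2 half - 1 / 4 * P * h)) (- 17 / 96 * P * h)"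
  proof -
    have "pcong 2 (1 / 8 * (gharm 2 half - 1 / 4 * P * h)) (1 / 8 * (- 7 / 6 * P * h - 1 / 4 * P * h))"
      by (intro pcong_cmult pcong_diff pcong_refl H2) auto
    thus ?thesis by (simp add: algebra_simps)
  qed
  ultimately have V: "pcong 4 (1 + V) (1 + P ^ 3 * (- 17 / 96 * h))"
    unfolding P_def by (rule one_plus_square_cong)
  have u96: "p_unit 96" using p_unit_smooth[of 5 1] by simp
  have "pcong 4 (g * (sine_prod half (P ^ 2) * (1 + V))) (1 + P ^ 3 * (- 1 / 24 * h + (7 / 96 * h + - 17 / 96 * h)))"
    using h u96 G Q V unfolding P_def
    by (intro one_plus_cube_mult_cong p_integral_add p_integral_mult p_integral_divide) auto
  also have "- 1 / 24 * h + (7 / 96 * h + - 17 / 96 * h) = - 7 / 48 * h" by simp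
  also have "pcong 4 (1 + P ^ 3 * (- 7 / 48 * h)) (1 + P ^ 3 * (- 7 / 48 * (- 2 * bernoulli (p - 3))))"
  proof -
    have "pcong (3 + 1) (1 + P ^ 3 * (- 7 / 48 * h)) (1 + P ^ 3 * (- 7 / 48 * (- 2 * bernoulli (p - 3))))"
      unfolding P_def h_def by (intro pcong_add pcong_refl pcong_scale pcong_cmult gharm_3_half_cong) auto
    thus ?thesis by simp
  qed
  finally have main: "pcong 4 (g * (sine_prod half (P ^ 2) * (1 + V))) (1 + P ^ 3 * (7 / 24 * bernoulli (p - 3)))"
    by simp
  \<comment> \<open>The term \<open>m = 0\<close> is split off: it is the common factor
    \<open>sine_prod half (P ^ 2)\<close> itself and supplies the 1 in \<open>1 + V\<close>.\<close>
  have "(\<Sum>m\<le>half. of_nat (p choose (2 * m)) * sine_prod half ((P - 4 * of_nat m)\<^sup>2)) =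
      (\<Sum>m\<in>insert 0 {1..half}. of_nat (p choose (2 * m)) * sine_prod half ((P - 4 * of_nat m)\<^sup>2))"
    by (rule sum.cong) auto
  also have "\<dots> = sine_prod half (P ^ 2) + (\<Sum>m=1..half. sine_prod half (P ^ 2) * (of_nat (p choose (2 * m)) * (P / (P - 4 * of_nat m) *
      (\<Prod>i<m. (P + 4 * of_nat i + 2) / (4 * of_nat i + 2 - 3 * P)))))"
  proof -
    have "sine_prod half ((P - 4 * of_nat m)\<^sup>2) = sine_prod half (P\<^sup>2) * (P / (P - 4 * of_nat m) *
      (\<Prod>i<m. (P + 4 * of_nat i + 2) / (4 * of_nat i + 2 - 3 * P)))" for m
      using sine_prod_odd[of half m] unfolding p_eq[symmetric] P_def .
    thus ?thesis by (subst sum.insert) (auto intro!: sum.cong)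
  qed
  also have "\<dots> = sine_prod half (P ^ 2) * (1 + V)"
    by (simp only: V_def P_def sum_distrib_left[symmetric] distrib_left mult_1_right)
  finally have sumeq: "(\<Sum>m\<le>half. of_nat (p choose (2 * m)) * sine_prod half ((P - 4 * of_nat m)\<^sup>2)) =
      sine_prod half (P ^ 2) * (1 + V)" .
  have "(\<Sum>k\<le>half. (6 * of_nat k + 1) * wz_term 0 k) =
     P * (of_nat ((2 * half) choose half) / 16 ^ half) * (sine_prod half (P ^ 2) * (1 + V))"
    using ramanujan_sum_eq_even[of half] unfolding p_eq[symmetric] P_def[symmetric] sumeq .
  also have "\<dots> = P ^ 1 * ((- 1) ^ half * (g * (sine_prod half (P ^ 2) * (1 + V))))"
    unfolding g_def mult.assoc sq by simp
  finally have "(\<Sum>k\<le>half. (6 * of_nat k + 1) * wz_term 0 k) = P ^ 1 * ((- 1) ^ half * (g * (sine_prod half (P ^ 2) * (1 + V))))" .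
  moreover have "pcong (1 + 4) (P ^ 1 * ((- 1) ^ half * (g * (sine_prod half (P ^ 2) * (1 + V)))))
     (P ^ 1 * ((- 1) ^ half * (1 + P ^ 3 * (7 / 24 * bernoulli (p - 3)))))"
    using main unfolding P_def by (intro pcong_scale pcong_cmult) auto
  ultimately show ?thesis unfolding P_def by simp
qed

end

theorem theorem1p1:
  fixes p :: nat
  assumes "prime p" and "p > 3"
  shows "rat_cong p 5
    (\<Sum>n = 0..(p - 1) div 2. of_nat (6 * n + 1) / 256 ^ n * of_nat ((2 * n) choose n) ^ 3)
    (of_nat p * (- 1) ^ ((p - 1) div 2)
      + (- 1) ^ ((p - 1) div 2) * (7 / 24) * of_nat p ^ 4 * bernoulli (p - 3))"
proof -
  interpret prime_gt_3 p using assms by unfold_locales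
  have lhs: "(\<Sum>n = 0..half. of_nat (6 * n + 1) / 256 ^ n * of_nat ((2 * n) choose n) ^ 3) =
      (\<Sum>k\<le>half. (6 * of_nat k + 1) * wz_term 0 k)"
    by (simp add: wz_term_at_0 atLeast0AtMost add.commute)
  have rhs: "of_nat p * (- 1) ^ half + (- 1) ^ half * (7 / 24) * of_nat p ^ 4 * bernoulli (p - 3) =
      of_nat p * ((- 1) ^ half * (1 + of_nat p ^ 3 * (7 / 24 * bernoulli (p - 3))))"
    by (simp add: algebra_simps eval_nat_numeral)
  \<comment> \<open>\<open>rat_cong\<close> also asks for integrality of both sides; that of the
    left side follows from this one through the congruence.\<close>
  have I: "p_integral p (of_nat p * ((- 1) ^ half * (1 + of_nat p ^ 3 * (7 / 24 * bernoulli (p - 3)))))"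
    by (intro p_integral_mult p_integral_add p_integral_power p_integral_divide bernoulli_integral) auto
  show ?thesis unfolding half_def[symmetric] lhs rhs rat_cong_def
    using I pcong_integral[OF ramanujan_sum_cong I] ramanujan_sum_cong by (auto simp: pcong_def)
qed

end
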